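(* Let $\gamma\ne\alpha$ be ordinals with $\gamma,\alpha<\omega_1$ and let $n,m\in\mathbb N$. Then $d_N\big(C([0,\omega^\gamma\cdot n]),C([0,\omega^\alpha\cdot m])\big)\ge2$, where $d_N$ denotes the net distance between Banach spaces.
   Context: $\mathbb N=\{1,2,\dots\}$. For an ordinal $\beta$, $C([0,\beta])$ is the Banach space of continuous real-valued functions on the ordinal interval $[0,\beta]$ (order topology) with the supremum norm. A net in a Banach space $X$ is a subset $\mathcal N\subset X$ for which there exist $a,b>0$ such that $\|x-x'\|\ge a$ for all distinct $x,x'\in\mathcal N$, and for every $x\in X$ there is $y\in\mathcal N$ with $\|x-y\|\le b$. A mapping $f:M\to N$ between metric spaces $(M,d)$ and $(N,\rho)$ is a Lipschitz embedding if there are $C_1,C_2>0$ with $C_1d(x,y)\le\rho(f(x),f(y))\le C_2d(x,y)$ for all $x,y\in M$; $\operatorname{dist}(f)$ is the infimum of $C_2/C_1$ over such constants. A surjective Lipschitz embedding is called a Lipschitz homeomorphism. The net distance between Banach spaces $X$ and $Y$ is $d_N(X,Y)=\inf\operatorname{dist}(f)$, where the infimum is over all Lipschitz homeomorphisms $f:\mathcal N\to\mathcal M$ between nets $\mathcal N\subset X$ and $\mathcal M\subset Y$ (with $\inf\emptyset=+\infty$). *)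

theory Defs
  imports "HOL-Analysis.Analysis" "HOL-Library.Countable_Set_Type" "HOL-Library.Multiset"
begin

unbundle cardinal_syntax

section \<open>Ordinals as well-order relations\<close>

text \<open>
  As in the theory of cardinals of HOL, an ordinal is a (reflexive) relation \<open>r\<close> with
  \<^const>\<open>Well_order\<close> \<open>r\<close>, taken up to the isomorphism \<open>=o\<close>; the elements of
  \<^term>\<open>Field r\<close> play the role of the ordinals strictly below \<open>r\<close>. The ordinal \<open>0\<close> is the empty
  relation, a natural number \<open>n\<close> is \<^term>\<open>natLeq_on n\<close>, and \<open>\<omega>\<close> is \<^const>\<open>natLeq\<close>.
\<close>

abbreviation omega_1 :: "nat set rel" where
  "omega_1 \<equiv> cardSuc natLeq"

lemma ordLess_omega_1_iff: "r <o omega_1 \<longleftrightarrow> Well_order r \<and> countable (Field r)"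
proof -
  have *: "countable (Field r) \<longleftrightarrow> |Field r| <o omega_1"
    by (simp add: countable_card_le_natLeq cardSuc_ordLeq_ordLess natLeq_Card_order card_of_Card_order)
  show ?thesis
  proof
    assume r: "r <o omega_1"
    then have "Well_order r"
      by (auto simp: ordLess_def)
    moreover from this have "|Field r| \<le>o r"
      by (simp add: card_of_least)
    ultimately show "Well_order r \<and> countable (Field r)"
      using * r ordLeq_ordLess_trans by blast
  next
    assume r: "Well_order r \<and> countable (Field r)"
    have card: "Card_order omega_1"
      by (simp add: cardSuc_Card_order natLeq_Card_order)
    then have "Well_order omega_1"
      using card_order_on_well_order_on by blast
    moreover have "\<not> omega_1 \<le>o r"
    proof
      assume "omega_1 \<le>o r"
      then have "|Field omega_1| \<le>o |Field r|"
        by (rule card_of_mono2)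
      then have "omega_1 \<le>o |Field r|"
        using card_of_Field_ordIso[OF card] ordIso_symmetric ordIso_ordLeq_trans by blast
      then show False
        using * r not_ordLess_ordLeq by blast
    qed
    ultimately show "r <o omega_1"
      using r not_ordLess_iff_ordLeq by blast
  qed
qed

text \<open>
  \<open>ord_succ r\<close> is the ordinal \<open>r + 1\<close>, that is, the ordinal interval \<open>[0, r]\<close>: the elements
  \<^term>\<open>Some x\<close> are the ordinals below \<open>r\<close>, and \<^const>\<open>None\<close> is the end point \<open>r\<close>.
\<close>
definition ord_succ :: "'a rel \<Rightarrow> 'a option rel" where
  "ord_succ r = {(Some x, Some y) |x y. (x, y) \<in> r}
     \<union> {(x, None) |x. x \<in> insert None (Some ` Field r)}"

text \<open>
  The product \<open>r \<cdot> s\<close>, that is, \<open>s\<close> consecutive copies of \<open>r\<close>: the second component is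
  the dominant one.
\<close>
definition ord_mult :: "'a rel \<Rightarrow> 'b rel \<Rightarrow> ('a \<times> 'b) rel" where
  "ord_mult r s = {((x, i), (y, j)) |x i y j.
     x \<in> Field r \<and> y \<in> Field r \<and> (i, j) \<in> s \<and> (i = j \<longrightarrow> (x, y) \<in> r)}"

text \<open>
  The power \<open>\<omega>\<^sup>r\<close>: the finitely supported functions from \<open>r\<close> to \<open>\<omega>\<close>,
  compared at the largest argument at which they differ. A function \<open>f\<close> stands for the Cantor
  normal form with coefficient \<open>f a\<close> at \<open>\<omega>\<^sup>a\<close>. The recursion equations of ordinal
  exponentiation are \<open>omega_pow_zero\<close>, \<open>omega_pow_succ\<close> and \<open>omega_pow_limit\<close> below.
\<close>
definition omega_pow_funs :: "'a rel \<Rightarrow> ('a \<Rightarrow> nat) set" where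
  "omega_pow_funs r = {f. finite {a. f a \<noteq> 0} \<and> {a. f a \<noteq> 0} \<subseteq> Field r}"

definition omega_pow :: "'a rel \<Rightarrow> ('a \<Rightarrow> nat) rel" where
  "omega_pow r = {(f, g). f \<in> omega_pow_funs r \<and> g \<in> omega_pow_funs r \<and>
     (f = g \<or> (\<exists>a. f a < g a \<and> (\<forall>b \<in> aboveS r a. f b = g b)))}"

lemma Field_ord_succ: "Field (ord_succ r) = insert None (Some ` Field r)"
  by (fastforce simp: ord_succ_def Field_def)

lemma Well_orderI:
  assumes "\<And>x. x \<in> Field r \<Longrightarrow> (x, x) \<in> r"
    and "\<And>x y z. (x, y) \<in> r \<Longrightarrow> (y, z) \<in> r \<Longrightarrow> (x, z) \<in> r"
    and "\<And>x y. (x, y) \<in> r \<Longrightarrow> (y, x) \<in> r \<Longrightarrow> x = y"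
    and "\<And>x y. x \<in> Field r \<Longrightarrow> y \<in> Field r \<Longrightarrow> (x, y) \<in> r \<or> (y, x) \<in> r"
    and "wf (r - Id)"
  shows "Well_order r"
  unfolding well_order_on_def linear_order_on_def partial_order_on_def preorder_on_def
    refl_on_def total_on_def trans_def antisym_def
  using assms by (auto intro: FieldI1 FieldI2; blast)

lemma Well_order_ord_succ:
  assumes "Well_order r"
  shows "Well_order (ord_succ r)"
proof (rule Well_orderI)
  interpret r: wo_rel r by (simp add: wo_rel_def assms)
  show "(x, x) \<in> ord_succ r" if "x \<in> Field (ord_succ r)" for x
    using that r.REFL unfolding Field_ord_succ by (auto simp: ord_succ_def refl_on_def)
  show "(x, z) \<in> ord_succ r" if "(x, y) \<in> ord_succ r" "(y, z) \<in> ord_succ r" for x y z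
    using that r.TRANS by (auto simp: ord_succ_def intro: FieldI1 dest: transD)
  show "x = y" if "(x, y) \<in> ord_succ r" "(y, x) \<in> ord_succ r" for x y
    using that r.ANTISYM by (auto simp: ord_succ_def dest: antisymD)
  show "(x, y) \<in> ord_succ r \<or> (y, x) \<in> ord_succ r"
    if "x \<in> Field (ord_succ r)" "y \<in> Field (ord_succ r)" for x y
    using that r.TOTALS unfolding Field_ord_succ by (auto simp: ord_succ_def) blast
  have "wf (r - Id)" using r.WF .
  show "wf (ord_succ r - Id)"
  proof (rule wfUNIVI)
    fix P x assume "\<forall>x. (\<forall>y. (y, x) \<in> ord_succ r - Id \<longrightarrow> P y) \<longrightarrow> P x"
    then have step: "\<And>x. (\<And>y. (y, x) \<in> ord_succ r - Id \<Longrightarrow> P y) \<Longrightarrow> P x" by blast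
    have Some: "P (Some a)" for a
      using r.WF
    proof (induction a rule: wf_induct_rule)
      case (less a)
      show ?case
        by (rule step) (auto simp: ord_succ_def intro: less)
    qed
    moreover have "P None"
      by (rule step) (auto simp: ord_succ_def Some)
    ultimately show "P x" by (cases x) auto
  qed
qed

lemma Field_ord_mult:
  assumes "Well_order r" "Well_order s"
  shows "Field (ord_mult r s) = Field r \<times> Field s"
proof -
  interpret r: wo_rel r by (simp add: wo_rel_def assms)
  interpret s: wo_rel s by (simp add: wo_rel_def assms)
  have "(p, p) \<in> ord_mult r s" if "p \<in> Field r \<times> Field s" for p
    using that r.REFL s.REFL by (auto simp: ord_mult_def refl_on_def)
  moreover have "p \<in> Field r \<times> Field s \<and> q \<in> Field r \<times> Field s" if "(p, q) \<in> ord_mult r s" for p q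
    using that by (auto simp: ord_mult_def intro: FieldI1 FieldI2)
  ultimately show ?thesis
    unfolding Field_def by blast
qed

lemma Well_order_ord_mult:
  assumes "Well_order r" "Well_order s"
  shows "Well_order (ord_mult r s)"
proof (rule Well_orderI)
  interpret r: wo_rel r by (simp add: wo_rel_def assms)
  interpret s: wo_rel s by (simp add: wo_rel_def assms)
  note F = Field_ord_mult[OF assms]
  show "(p, p) \<in> ord_mult r s" if "p \<in> Field (ord_mult r s)" for p
    using that r.REFL s.REFL unfolding F by (auto simp: ord_mult_def refl_on_def)
  show "(p, t) \<in> ord_mult r s" if "(p, q) \<in> ord_mult r s" "(q, t) \<in> ord_mult r s" for p q t
    using that r.TRANS s.TRANS s.ANTISYM
    by (auto simp: ord_mult_def dest: transD antisymD)
  show "p = q" if "(p, q) \<in> ord_mult r s" "(q, p) \<in> ord_mult r s" for p q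
    using that r.ANTISYM s.ANTISYM by (auto simp: ord_mult_def dest: antisymD)
  show "(p, q) \<in> ord_mult r s \<or> (q, p) \<in> ord_mult r s"
    if "p \<in> Field (ord_mult r s)" "q \<in> Field (ord_mult r s)" for p q
    using that r.TOTALS s.TOTALS unfolding F by (auto simp: ord_mult_def) blast+
  have "wf (inv_image ((s - Id) <*lex*> (r - Id)) prod.swap)"
    by (intro wf_inv_image wf_lex_prod r.WF s.WF)
  then show "wf (ord_mult r s - Id)"
    by (rule wf_subset) (auto simp: ord_mult_def inv_image_def)
qed

lemma Field_omega_pow: "Field (omega_pow r) = omega_pow_funs r"
  by (auto simp: omega_pow_def Field_def)

lemma finite_has_max:
  assumes "Well_order r" "finite D" "D \<noteq> {}" "D \<subseteq> Field r"
  shows "\<exists>a\<in>D. \<forall>b\<in>D. (b, a) \<in> r"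
proof -
  interpret r: wo_rel r by (simp add: wo_rel_def assms)
  show ?thesis
    using assms(2-4)
  proof (induction D rule: finite_ne_induct)
    case (singleton x)
    then show ?case using r.REFL by (auto simp: refl_on_def)
  next
    case (insert x F)
    then obtain a where a: "a \<in> F" "\<forall>b\<in>F. (b, a) \<in> r" by auto
    show ?case
    proof (cases "(x, a) \<in> r")
      case False
      then have "(a, x) \<in> r" "(x, x) \<in> r" using r.TOTALS insert.prems a by auto
      then show ?thesis using a r.TRANS by (auto dest: transD)
    qed (use a in auto)
  qed
qed

lemma omega_pow_diff:
  assumes "Well_order r" "f \<in> omega_pow_funs r" "g \<in> omega_pow_funs r" "f \<noteq> g"
  obtains a where "a \<in> Field r" "f a \<noteq> g a" "\<And>b. b \<in> aboveS r a \<Longrightarrow> f b = g b"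
proof -
  interpret r: wo_rel r by (simp add: wo_rel_def assms)
  let ?D = "{a. f a \<noteq> g a}"
  have sub: "?D \<subseteq> {a. f a \<noteq> 0} \<union> {a. g a \<noteq> 0}" by auto
  then have fin: "finite ?D"
    using assms(2,3) by (auto simp: omega_pow_funs_def intro: finite_subset)
  have F: "?D \<subseteq> Field r" using sub assms(2,3) by (auto simp: omega_pow_funs_def)
  have "?D \<noteq> {}" using assms(4) by auto
  from finite_has_max[OF assms(1) fin this F]
  obtain a where a: "f a \<noteq> g a" "\<And>b. f b \<noteq> g b \<Longrightarrow> (b, a) \<in> r" by auto
  have "f b = g b" if "b \<in> aboveS r a" for b
    using that a(2)[of b] r.ANTISYM by (auto simp: aboveS_def dest: antisymD)
  with a F show thesis by (intro that) auto
qed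

lemma Well_order_omega_pow:
  assumes "Well_order r"
  shows "Well_order (omega_pow r)"
proof (rule Well_orderI)
  interpret r: wo_rel r by (simp add: wo_rel_def assms)
  note F = Field_omega_pow
  have supp: "a \<in> Field r" if "f \<in> omega_pow_funs r" "f a \<noteq> 0" for f a
    using that by (auto simp: omega_pow_funs_def)
  show "(f, f) \<in> omega_pow r" if "f \<in> Field (omega_pow r)" for f
    using that unfolding F by (auto simp: omega_pow_def)
  have trans: "(f, h) \<in> omega_pow r" if "(f, g) \<in> omega_pow r" "(g, h) \<in> omega_pow r" for f g h
  proof (cases "f = g \<or> g = h")
    case False
    with that obtain a b where a: "f a < g a" "\<forall>c \<in> aboveS r a. f c = g c"
      and b: "g b < h b" "\<forall>c \<in> aboveS r b. g c = h c"
      and funs: "f \<in> omega_pow_funs r" "g \<in> omega_pow_funs r" "h \<in> omega_pow_funs r"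
      by (auto simp: omega_pow_def)
    then have "a \<in> Field r" "b \<in> Field r" using supp by (metis not_less_zero)+
    then consider "a = b" | "b \<in> aboveS r a" | "a \<in> aboveS r b"
      using r.TOTALS by (auto simp: aboveS_def)
    then have "\<exists>a. f a < h a \<and> (\<forall>c \<in> aboveS r a. f c = h c)"
    proof cases
      case 1
      with a b show ?thesis by (intro exI[of _ a]) auto
    next
      case 2
      then have "aboveS r b \<subseteq> aboveS r a"
        using r.TRANS r.ANTISYM by (auto simp: aboveS_def dest: transD antisymD)
      with a b 2 show ?thesis by (intro exI[of _ b]) auto
    next
      case 3
      then have "aboveS r a \<subseteq> aboveS r b"
        using r.TRANS r.ANTISYM by (auto simp: aboveS_def dest: transD antisymD)
      with a b 3 show ?thesis by (intro exI[of _ a]) auto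
    qed
    with funs show ?thesis by (auto simp: omega_pow_def)
  qed (use that in auto)
  then show "\<And>f g h. (f, g) \<in> omega_pow r \<Longrightarrow> (g, h) \<in> omega_pow r \<Longrightarrow> (f, h) \<in> omega_pow r" .
  show "(f, g) \<in> omega_pow r \<or> (g, f) \<in> omega_pow r"
    if "f \<in> Field (omega_pow r)" "g \<in> Field (omega_pow r)" for f g
  proof (cases "f = g")
    case False
    from omega_pow_diff[OF assms that[unfolded F] False] obtain a
      where "f a \<noteq> g a" "\<And>b. b \<in> aboveS r a \<Longrightarrow> f b = g b" by blast
    with that[unfolded F] show ?thesis
      by (cases "f a < g a") (auto simp: omega_pow_def intro!: exI[of _ a])
  qed (use that[unfolded F] in \<open>auto simp: omega_pow_def\<close>)
  let ?M = Abs_multiset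
  have "(?M f, ?M g) \<in> mult (r - Id)" if "(f, g) \<in> omega_pow r - Id" for f g
  proof -
    from that obtain a where a: "f a < g a" "\<forall>b \<in> aboveS r a. f b = g b"
      and funs: "f \<in> omega_pow_funs r" "g \<in> omega_pow_funs r"
      by (auto simp: omega_pow_def)
    have "a \<in> Field r" using supp funs(2) a(1) by (metis not_less_zero)
    have c: "count (?M f) = f" "count (?M g) = g"
      using funs by (simp_all add: omega_pow_funs_def)
    let ?I = "filter_mset (\<lambda>x. x \<notin> underS r a) (?M f)"
    let ?K = "filter_mset (\<lambda>x. x \<in> underS r a) (?M f)"
    let ?J = "?M g - ?I"
    have le: "?I \<subseteq># ?M g"
    proof (rule mset_subset_eqI)
      fix x
      show "count ?I x \<le> count (?M g) x"
      proof (cases "x \<in> underS r a \<or> f x = 0")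
        case False
        then have "x \<in> Field r" using supp funs(1) by auto
        with False \<open>a \<in> Field r\<close> r.TOTALS have "x = a \<or> x \<in> aboveS r a"
          by (auto simp: underS_def aboveS_def)
        with a show ?thesis by (auto simp: c)
      qed (auto simp: c)
    qed
    have "a \<in># ?J"
      using a(1) by (auto simp: c in_diff_count underS_def)
    then have "(?I + ?K, ?I + ?J) \<in> mult (r - Id)"
      by (intro one_step_implies_mult) (auto simp: underS_def)
    moreover have "?I + ?K = ?M f"
      by (metis multiset_partition add.commute)
    moreover have "?I + ?J = ?M g"
      using le by simp
    ultimately show ?thesis by simp
  qed
  then have "omega_pow r - Id \<subseteq> inv_image (mult (r - Id)) ?M"
    by (auto simp: inv_image_def)
  moreover have "wf (inv_image (mult (r - Id)) ?M)"
    by (intro wf_inv_image wf_mult r.WF)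
  ultimately show "wf (omega_pow r - Id)"
    using wf_subset by blast
  show "f = g" if "(f, g) \<in> omega_pow r" "(g, f) \<in> omega_pow r" for f g
  proof (rule ccontr)
    assume "f \<noteq> g"
    with that have "(f, g) \<in> omega_pow r - Id" "(g, f) \<in> omega_pow r - Id" by auto
    then show False using \<open>wf (omega_pow r - Id)\<close> by (meson wf_asym)
  qed
qed

lemma omega_pow_zero: "omega_pow {} =o natLeq_on 1"
proof -
  have "omega_pow ({} :: 'a rel) = {(\<lambda>_. 0, \<lambda>_. 0)}"
    by (auto simp: omega_pow_def omega_pow_funs_def fun_eq_iff)
  moreover have "natLeq_on 1 = {(0, 0)}"
    by auto
  moreover have "Well_order (omega_pow ({} :: 'a rel))"
    by (intro Well_order_omega_pow) simp
  ultimately show ?thesis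
    using natLeq_on_Well_order[of 1]
    by (auto simp: ordIso_def iso_iff2 bij_betw_def intro!: exI[of _ "\<lambda>_. 0"])
qed

lemma omega_pow_succ:
  assumes "Well_order r"
  shows "omega_pow (ord_succ r) =o ord_mult (omega_pow r) natLeq"
proof -
  let ?h = "\<lambda>f :: 'a option \<Rightarrow> nat. (f \<circ> Some, f None)"
  note W = Well_order_omega_pow[OF assms]
  have split: "{a. f a \<noteq> 0} \<subseteq> insert None (Some ` {a. f (Some a) \<noteq> 0})" for f :: "'a option \<Rightarrow> nat"
  proof
    fix a assume "a \<in> {a. f a \<noteq> 0}"
    then show "a \<in> insert None (Some ` {a. f (Some a) \<noteq> 0})" by (cases a) auto
  qed
  have fin: "finite {a. f a \<noteq> 0} \<longleftrightarrow> finite {a. f (Some a) \<noteq> 0}" for f :: "'a option \<Rightarrow> nat"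
  proof
    assume "finite {a. f a \<noteq> 0}"
    then have "finite (Some -` {a. f a \<noteq> 0})" by (rule finite_vimageI) simp
    then show "finite {a. f (Some a) \<noteq> 0}" by (simp add: vimage_def)
  next
    assume "finite {a. f (Some a) \<noteq> 0}"
    then show "finite {a. f a \<noteq> 0}" using finite_subset[OF split] by blast
  qed
  have mem: "f \<in> omega_pow_funs (ord_succ r) \<longleftrightarrow> f \<circ> Some \<in> omega_pow_funs r" for f
  proof -
    have "{a. f a \<noteq> 0} \<subseteq> insert None (Some ` Field r) \<longleftrightarrow> {a. f (Some a) \<noteq> 0} \<subseteq> Field r"
      using split[of f] by auto
    then show ?thesis
      unfolding omega_pow_funs_def mem_Collect_eq fin Field_ord_succ by simp
  qed
  have inj: "f = g" if "f \<circ> Some = g \<circ> Some" "f None = g None" for f g :: "'a option \<Rightarrow> nat"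
  proof
    fix x show "f x = g x" using that by (cases x) (auto simp: fun_eq_iff)
  qed
  have "bij_betw ?h (omega_pow_funs (ord_succ r)) (omega_pow_funs r \<times> UNIV)"
  proof (intro bij_betwI')
    show "?h f = ?h g \<longleftrightarrow> f = g" for f g by (auto dest: inj)
    show "?h f \<in> omega_pow_funs r \<times> UNIV" if "f \<in> omega_pow_funs (ord_succ r)" for f
      using that by (simp add: mem)
    show "\<exists>f \<in> omega_pow_funs (ord_succ r). p = ?h f" if "p \<in> omega_pow_funs r \<times> UNIV" for p
      using that by (intro bexI[of _ "case_option (snd p) (fst p)"]) (auto simp: mem comp_def)
  qed
  moreover have "(f, g) \<in> omega_pow (ord_succ r) \<longleftrightarrow> (?h f, ?h g) \<in> ord_mult (omega_pow r) natLeq"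
    if "f \<in> omega_pow_funs (ord_succ r)" "g \<in> omega_pow_funs (ord_succ r)" for f g
  proof -
    have 1: "aboveS (ord_succ r) None = {}"
      by (auto simp: aboveS_def ord_succ_def)
    have 2: "aboveS (ord_succ r) (Some a) = insert None (Some ` aboveS r a)" if "a \<in> Field r" for a
      using that by (auto simp: aboveS_def ord_succ_def)
    have 3: "a \<in> Field r" if "f (Some a) < g (Some a)" for a
    proof -
      have "g (Some a) \<noteq> 0" using that by simp
      then show ?thesis using \<open>g \<in> _\<close> unfolding omega_pow_funs_def Field_ord_succ by blast
    qed
    have "(\<exists>a. f a < g a \<and> (\<forall>b \<in> aboveS (ord_succ r) a. f b = g b)) \<longleftrightarrow>
      f None < g None \<or> f None = g None \<and>
        (\<exists>a. f (Some a) < g (Some a) \<and> (\<forall>b \<in> aboveS r a. f (Some b) = g (Some b)))"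
      (is "(\<exists>a. ?P a) \<longleftrightarrow> _")
    proof -
      have "(\<exists>a. ?P a) \<longleftrightarrow> ?P None \<or> (\<exists>a. ?P (Some a))"
        by (metis option.exhaust)
      moreover have "?P (Some a) \<longleftrightarrow> f None = g None \<and>
        f (Some a) < g (Some a) \<and> (\<forall>b \<in> aboveS r a. f (Some b) = g (Some b))" for a
        by (cases "f (Some a) < g (Some a)") (auto simp: 2 3)
      ultimately show ?thesis by (auto simp: 1)
    qed
    moreover have "f = g \<longleftrightarrow> f None = g None \<and> f \<circ> Some = g \<circ> Some"
      using inj by auto
    ultimately show ?thesis
      using that
      by (auto simp: omega_pow_def ord_mult_def natLeq_def mem Field_omega_pow[unfolded omega_pow_def])
  qed
  ultimately have "iso (omega_pow (ord_succ r)) (ord_mult (omega_pow r) natLeq) ?h"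
    unfolding iso_iff2 Field_ord_mult[OF W natLeq_Well_order] Field_omega_pow Field_natLeq by blast
  then show ?thesis
    using Well_order_omega_pow[OF Well_order_ord_succ[OF assms]]
      Well_order_ord_mult[OF W natLeq_Well_order]
    unfolding ordIso_def by blast
qed

lemma omega_pow_underS:
  assumes "Well_order r" "a \<in> Field r"
  defines "s \<equiv> Restr r (underS r a)"
  shows "omega_pow s = Restr (omega_pow r) (Field (omega_pow s))"
    and "wo_rel.ofilter (omega_pow r) (Field (omega_pow s))"
proof -
  interpret r: wo_rel r by (simp add: wo_rel_def assms)
  have F: "Field s = underS r a"
    using r.REFL by (auto simp: s_def Field_def underS_def refl_on_def)
  have sub: "omega_pow_funs s \<subseteq> omega_pow_funs r"
    by (auto simp: omega_pow_funs_def F underS_def intro: FieldI1)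
  have zero: "g b = 0" if "g \<in> omega_pow_funs s" "b \<notin> underS r a" for g b
    using that by (auto simp: omega_pow_funs_def F)
  have *: "(\<forall>b \<in> aboveS s c. f b = g b) \<longleftrightarrow> (\<forall>b \<in> aboveS r c. f b = g b)"
    if "f \<in> omega_pow_funs s" "g \<in> omega_pow_funs s" "f c < g c" for f g c
  proof -
    have "c \<in> underS r a" using zero[OF that(2)] that(3) by fastforce
    then have "aboveS s c = aboveS r c \<inter> underS r a"
      by (auto simp: aboveS_def s_def)
    then show ?thesis using zero[OF that(1)] zero[OF that(2)] by (metis IntE IntI)
  qed
  have "(f, g) \<in> omega_pow s \<longleftrightarrow> (f, g) \<in> omega_pow r"
    if "f \<in> omega_pow_funs s" "g \<in> omega_pow_funs s" for f g
  proof -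
    have "f \<in> omega_pow_funs r" "g \<in> omega_pow_funs r" using that sub by auto
    with that * [OF that] show ?thesis
      unfolding omega_pow_def mem_Collect_eq prod.case by metis
  qed
  moreover have "omega_pow s \<subseteq> omega_pow_funs s \<times> omega_pow_funs s"
    by (auto simp: omega_pow_def)
  ultimately show "omega_pow s = Restr (omega_pow r) (Field (omega_pow s))"
    unfolding Field_omega_pow by auto
  interpret o: wo_rel "omega_pow r"
    by (simp add: wo_rel_def Well_order_omega_pow assms)
  have "f \<in> omega_pow_funs s" if g: "g \<in> omega_pow_funs s" and fg: "(f, g) \<in> omega_pow r" for f g
  proof (cases "f = g")
    case False
    with fg obtain c where c: "f c < g c" "\<forall>b \<in> aboveS r c. f b = g b"
      and f: "f \<in> omega_pow_funs r" by (auto simp: omega_pow_def)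
    have cU: "c \<in> underS r a" using zero[OF g] c by fastforce
    have "x \<in> underS r a" if "f x \<noteq> 0" for x
    proof (rule ccontr)
      assume "x \<notin> underS r a"
      moreover have "x \<in> Field r" using f that by (auto simp: omega_pow_funs_def)
      ultimately have "(a, x) \<in> r"
        using r.TOTALS assms(2) r.REFL by (auto simp: underS_def refl_on_def)
      then have "x \<in> aboveS r c"
        using cU r.TRANS r.ANTISYM by (auto simp: aboveS_def underS_def dest: transD antisymD)
      with c zero[OF g \<open>x \<notin> _\<close>] that show False by auto
    qed
    with f show ?thesis by (auto simp: omega_pow_funs_def F)
  qed (use g in simp)
  then show "wo_rel.ofilter (omega_pow r) (Field (omega_pow s))"
    unfolding o.ofilter_def Field_omega_pow using sub by (auto simp: under_def)
qed

text \<open>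
  For a limit ordinal \<open>r\<close>, \<open>omega_pow r\<close> is the union, hence the supremum, of its initial segments
  \<open>\<omega>\<^sup>a\<close> for \<open>a < r\<close>.
\<close>
lemma omega_pow_limit:
  assumes "Well_order r" "Field r \<noteq> {}" "\<And>a. a \<in> Field r \<Longrightarrow> aboveS r a \<noteq> {}"
  shows "omega_pow r = (\<Union>a \<in> Field r. omega_pow (Restr r (underS r a)))"
proof -
  interpret r: wo_rel r by (simp add: wo_rel_def assms)
  have F: "Field (Restr r (underS r a)) = underS r a" for a
    using r.REFL by (auto simp: Field_def underS_def refl_on_def)
  have "\<exists>a \<in> Field r. (f, g) \<in> omega_pow (Restr r (underS r a))" if "(f, g) \<in> omega_pow r" for f g
  proof -
    have fg: "f \<in> omega_pow_funs r" "g \<in> omega_pow_funs r"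
      using that by (auto simp: omega_pow_def)
    obtain z where z: "z \<in> Field r" using assms(2) by auto
    define D where "D = insert z ({a. f a \<noteq> 0} \<union> {a. g a \<noteq> 0})"
    have "finite D" "D \<noteq> {}" "D \<subseteq> Field r"
      using fg z by (auto simp: D_def omega_pow_funs_def)
    from finite_has_max[OF assms(1) this] obtain m
      where m: "m \<in> Field r" "\<And>b. b \<in> D \<Longrightarrow> (b, m) \<in> r"
      using \<open>D \<subseteq> Field r\<close> by auto
    obtain a where a: "a \<in> aboveS r m" using assms(3) m(1) by auto
    then have "a \<in> Field r" by (auto simp: aboveS_def intro: FieldI2)
    have "D \<subseteq> underS r a"
      using m(2) a r.TRANS r.ANTISYM by (auto simp: aboveS_def underS_def dest: transD antisymD)
    then have "f \<in> omega_pow_funs (Restr r (underS r a))" "g \<in> omega_pow_funs (Restr r (underS r a))"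
      using fg by (auto simp: omega_pow_funs_def F D_def)
    then have "(f, g) \<in> omega_pow (Restr r (underS r a))"
      using that omega_pow_underS(1)[OF assms(1) \<open>a \<in> Field r\<close>] by (auto simp: Field_omega_pow)
    with \<open>a \<in> Field r\<close> show ?thesis by blast
  qed
  moreover have "omega_pow (Restr r (underS r a)) \<subseteq> omega_pow r" if "a \<in> Field r" for a
    using omega_pow_underS(1)[OF assms(1) that] by blast
  ultimately show ?thesis by auto
qed



section \<open>Spaces of continuous functions on ordinal intervals\<close>

definition ord_topology :: "'a rel \<Rightarrow> 'a topology" where
  "ord_topology r =
     topology_generated_by ({Field r} \<union> underS r ` Field r \<union> aboveS r ` Field r)"

text \<open>
  \<open>C([0, \<beta>])\<close> as a metric space, with the metric induced by the supremum norm
  (see \<open>mspace_C_interval\<close> and \<open>mdist_C_interval\<close> below).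
  As usual for \<^const>\<open>cfunspace\<close>, functions are \<^const>\<open>undefined\<close> outside the interval.
\<close>
definition C_interval :: "'a rel \<Rightarrow> ('a option \<Rightarrow> real) metric" where
  "C_interval \<beta> = cfunspace (ord_topology (ord_succ \<beta>)) euclidean_metric"

lemma topspace_ord_topology [simp]: "topspace (ord_topology r) = Field r"
  by (auto simp: ord_topology_def underS_def aboveS_def intro: FieldI1 FieldI2)

lemma openin_ord_topology_left:
  assumes "Well_order r" "openin (ord_topology r) U" "a \<in> U"
  shows "under r a \<subseteq> U \<or> (\<exists>b \<in> underS r a. aboveS r b \<inter> under r a \<subseteq> U)"
proof -
  interpret r: wo_rel r by (simp add: wo_rel_def assms)
  have "generate_topology_on ({Field r} \<union> underS r ` Field r \<union> aboveS r ` Field r) U"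
    using assms(2) unfolding ord_topology_def openin_topology_generated_by_iff .
  then show ?thesis
    using assms(3)
  proof (induction rule: generate_topology_on.induct)
    case Empty
    then show ?case by simp
  next
    case (UN K)
    then show ?case by (meson Union_upper UnionE subset_trans)
  next
    case (Int U V)
    then have "a \<in> U" "a \<in> V" by auto
    from Int.IH(1)[OF this(1)] Int.IH(2)[OF this(2)] show ?case
    proof (elim disjE bexE)
      fix b c
      assume b: "b \<in> underS r a" "aboveS r b \<inter> under r a \<subseteq> U"
        and c: "c \<in> underS r a" "aboveS r c \<inter> under r a \<subseteq> V"
      have "(b, c) \<in> r \<or> (c, b) \<in> r"
        using b(1) c(1) r.TOTALS unfolding underS_def by (blast intro: FieldI1)
      then show ?thesis
      proof
        assume "(b, c) \<in> r"
        then have "aboveS r c \<subseteq> aboveS r b"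
          using r.TRANS r.ANTISYM by (auto simp: aboveS_def dest: transD antisymD)
        with b c show ?thesis by blast
      next
        assume "(c, b) \<in> r"
        then have "aboveS r b \<subseteq> aboveS r c"
          using r.TRANS r.ANTISYM by (auto simp: aboveS_def dest: transD antisymD)
        with b c show ?thesis by blast
      qed
    qed blast+
  next
    case (Basis S)
    then consider "S = Field r" | c where "S = underS r c" | c where "S = aboveS r c" by auto
    then show ?case
    proof cases
      case 1
      then show ?thesis by (auto simp: under_def intro: FieldI1)
    next
      case 2
      then have "under r a \<subseteq> S"
        using Basis r.TRANS r.ANTISYM by (auto simp: underS_def under_def dest: transD antisymD)
      then show ?thesis ..
    next
      case 3
      then have "c \<in> underS r a" "aboveS r c \<inter> under r a \<subseteq> S"
        using Basis by (auto simp: aboveS_def underS_def)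
      then show ?thesis by blast
    qed
  qed
qed

lemma compact_space_ord_succ:
  assumes "Well_order \<beta>"
  shows "compact_space (ord_topology (ord_succ \<beta>))"
proof -
  define r where "r = ord_succ \<beta>"
  have W: "Well_order r" using assms by (simp add: r_def Well_order_ord_succ)
  interpret r: wo_rel r by (simp add: wo_rel_def W)
  have "\<exists>F. finite F \<and> F \<subseteq> \<U> \<and> Field r \<subseteq> \<Union>F"
    if opn: "\<And>U. U \<in> \<U> \<Longrightarrow> openin (ord_topology r) U" and cov: "Field r \<subseteq> \<Union>\<U>" for \<U>
  proof -
    have *: "\<exists>F. finite F \<and> F \<subseteq> \<U> \<and> under r a \<subseteq> \<Union>F" if "a \<in> Field r" for a
      using r.WF that
    proof (induction a rule: wf_induct_rule)
      case (less a)
      then obtain U where U: "U \<in> \<U>" "a \<in> U" using cov by blast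
      from openin_ord_topology_left[OF W opn[OF U(1)] U(2)] show ?case
      proof (elim disjE bexE)
        assume "under r a \<subseteq> U"
        with U show ?thesis by (intro exI[of _ "{U}"]) auto
      next
        fix b assume b: "b \<in> underS r a" "aboveS r b \<inter> under r a \<subseteq> U"
        then obtain F where F: "finite F" "F \<subseteq> \<U>" "under r b \<subseteq> \<Union>F"
          using less.IH[of b] by (auto simp: underS_def intro: FieldI1)
        have "under r a \<subseteq> under r b \<union> (aboveS r b \<inter> under r a)"
          using b(1) r.TOTALS r.REFL
          by (auto simp: under_def underS_def aboveS_def refl_on_def dest: FieldI1)
        with b F U show ?thesis by (intro exI[of _ "insert U F"]) auto
      qed
    qed
    have "None \<in> Field r" "Field r \<subseteq> under r None"
      unfolding r_def Field_ord_succ by (auto simp: under_def ord_succ_def)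
    with * show ?thesis by (meson subset_trans)
  qed
  then show ?thesis
    unfolding compact_space_alt r_def by simp
qed

lemma mspace_C_interval:
  assumes "Well_order \<beta>"
  shows "mspace (C_interval \<beta>) = {f \<in> extensional (Field (ord_succ \<beta>)).
    continuous_map (ord_topology (ord_succ \<beta>)) euclideanreal f}"
  using compactin_mspace_cfunspace[of "ord_topology (ord_succ \<beta>)" "euclidean_metric :: real metric"]
    compact_space_ord_succ[OF assms]
  by (auto simp: C_interval_def compact_space_def)

lemma mdist_C_interval:
  assumes "f \<in> mspace (C_interval \<beta>)" "g \<in> mspace (C_interval \<beta>)"
  shows "mdist (C_interval \<beta>) f g = (SUP x \<in> Field (ord_succ \<beta>). \<bar>f x - g x\<bar>)"
proof -
  have "f \<in> Met_TC.fspace (Field (ord_succ \<beta>))" "g \<in> Met_TC.fspace (Field (ord_succ \<beta>))"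
    using assms by (auto simp: C_interval_def Met_TC.fspace_def)
  then show ?thesis
    by (simp add: C_interval_def mdist_cfunspace_eq_mdist_funspace Met_TC.fdist_def
        Field_ord_succ dist_real_def)
qed


section \<open>Nets and the net distance\<close>

definition is_net :: "'a metric \<Rightarrow> 'a set \<Rightarrow> bool" where
  "is_net X N \<longleftrightarrow> N \<subseteq> mspace X \<and> (\<exists>a > 0. \<exists>b > 0.
     (\<forall>x \<in> N. \<forall>x' \<in> N. x \<noteq> x' \<longrightarrow> a \<le> mdist X x x') \<and>
     (\<forall>x \<in> mspace X. \<exists>y \<in> N. mdist X x y \<le> b))"

definition bilipschitz_constants :: "'a metric \<Rightarrow> 'b metric \<Rightarrow> ('a \<Rightarrow> 'b) \<Rightarrow> (real \<times> real) set"
  where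
  "bilipschitz_constants M N f = {(C\<^sub>1, C\<^sub>2). 0 < C\<^sub>1 \<and> 0 < C\<^sub>2 \<and>
     (\<forall>x \<in> mspace M. \<forall>y \<in> mspace M.
        C\<^sub>1 * mdist M x y \<le> mdist N (f x) (f y) \<and> mdist N (f x) (f y) \<le> C\<^sub>2 * mdist M x y)}"

definition lipschitz_embedding :: "'a metric \<Rightarrow> 'b metric \<Rightarrow> ('a \<Rightarrow> 'b) \<Rightarrow> bool" where
  "lipschitz_embedding M N f \<longleftrightarrow>
     f \<in> mspace M \<rightarrow> mspace N \<and> bilipschitz_constants M N f \<noteq> {}"

definition lipschitz_homeomorphism :: "'a metric \<Rightarrow> 'b metric \<Rightarrow> ('a \<Rightarrow> 'b) \<Rightarrow> bool" where
  "lipschitz_homeomorphism M N f \<longleftrightarrow> lipschitz_embedding M N f \<and> f ` mspace M = mspace N"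

definition distortion :: "'a metric \<Rightarrow> 'b metric \<Rightarrow> ('a \<Rightarrow> 'b) \<Rightarrow> ereal" where
  "distortion M N f = (INF (C\<^sub>1, C\<^sub>2) \<in> bilipschitz_constants M N f. ereal (C\<^sub>2 / C\<^sub>1))"

text \<open>The infimum of the empty set is \<open>\<infinity>\<close> in \<^typ>\<open>ereal\<close>.\<close>
definition net_distance :: "'a metric \<Rightarrow> 'b metric \<Rightarrow> ereal" where
  "net_distance X Y = Inf {distortion (submetric X N) (submetric Y M) f |N M f.
     is_net X N \<and> is_net Y M \<and> lipschitz_homeomorphism (submetric X N) (submetric Y M) f}"

end

theory Submission
  imports Defs
begin

text \<open>
  Composing with nearest-point maps, a net homeomorphism of distortion \<open>c / a < 2\<close> yields, in
  both directions, a map \<open>h\<close> with \<open>a * d x y - b \<le> d (h x) (h y) \<le> c * d x y + b\<close>. We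
  show that such a map \<open>C(L) \<rightarrow> C(K)\<close> forces the Cantor--Bendixson rank of \<open>K\<close> to be at least
  that of \<open>L\<close>. For a clopen \<open>A\<close> let \<open>y A\<close> be \<open>R\<close> on \<open>A\<close> and \<open>-R\<close> elsewhere, with \<open>R\<close> large.
  Given a clopen \<open>U \<noteq> {}\<close>, the functions that are \<open>2R\<close> and \<open>-2R\<close> on \<open>U\<close> and vanish elsewhere
  are \<open>4R\<close> apart, and they are within \<open>R\<close> of \<open>y A\<close> and \<open>y (L - A)\<close>, respectively, for every
  clopen \<open>A \<supseteq> U\<close>. As \<open>4a > 2c\<close>, there are a point \<open>t\<close> of \<open>K\<close> and a sign \<open>s\<close> with
  \<open>s * (h (y A) t - h (y (L - A)) t) \<ge> 1\<close> for all those \<open>A\<close> at once. The set \<open>T U\<close> of these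
  \<open>t\<close> is closed and increases with \<open>U\<close>, and disjoint \<open>U\<close> cannot share both \<open>t\<close> and \<open>s\<close>. Hence,
  by induction on \<open>\<eta>\<close>, \<open>T U\<close> contains a point of rank at least \<open>\<eta>\<close> whenever \<open>U\<close> does:
  infinitely many disjoint clopen pieces of \<open>U\<close> give infinitely many points of \<open>T U\<close>, which
  accumulate at a point of larger rank.
\<close>

section \<open>Clopen sets and ranks in ordinal intervals\<close>

lemma openin_ord_topology_rays:
  assumes "a \<in> Field r"
  shows "openin (ord_topology r) (underS r a)" "openin (ord_topology r) (aboveS r a)"
  using assms unfolding ord_topology_def by (auto intro!: topology_generated_by_Basis)

text \<open>The complement is the open ray above \<open>a\<close>. The set itself is everything if
  \<open>a\<close> is the last element, and otherwise the open ray below the successor of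
  \<open>a\<close>.\<close>

lemma clopen_under:
  assumes "Well_order r" "a \<in> Field r"
  shows "openin (ord_topology r) (under r a)" "closedin (ord_topology r) (under r a)"
proof -
  interpret r: wo_rel r by (simp add: wo_rel_def assms)
  have diff: "Field r - under r a = aboveS r a"
    using r.TOTALS r.REFL r.ANTISYM assms(2)
    by (auto simp: under_def aboveS_def refl_on_def dest: antisymD intro: FieldI2)
  have sub: "under r a \<subseteq> Field r"
    by (auto simp: under_def intro: FieldI1)
  show "closedin (ord_topology r) (under r a)"
    unfolding closedin_def using diff sub openin_ord_topology_rays[OF assms(2)] by simp
  show "openin (ord_topology r) (under r a)"
  proof (cases "aboveS r a = {}")
    case True
    then have "under r a = Field r" using diff sub by blast
    then show ?thesis by (metis openin_topspace topspace_ord_topology)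
  next
    case False
    define b where "b = r.minim (aboveS r a)"
    have A: "aboveS r a \<subseteq> Field r" by (auto simp: aboveS_def intro: FieldI2)
    have b: "b \<in> aboveS r a" unfolding b_def using r.minim_in[OF A False] .
    have bl: "(b, c) \<in> r" if "c \<in> aboveS r a" for c
      unfolding b_def using r.minim_least[OF A that] .
    have "under r a = underS r b"
    proof (intro equalityI subsetI)
      fix x assume "x \<in> under r a"
      then show "x \<in> underS r b"
        using b r.TRANS r.ANTISYM by (auto simp: under_def underS_def aboveS_def dest: transD antisymD)
    next
      fix x assume x: "x \<in> underS r b"
      then have "x \<notin> aboveS r a" "x \<in> Field r"
        using bl r.ANTISYM by (auto simp: underS_def dest: antisymD intro: FieldI1)
      then show "x \<in> under r a" using diff by blast
    qed
    then show ?thesis using openin_ord_topology_rays[of b r] A b by auto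
  qed
qed

text \<open>\<open>N q\<close> is the part of \<open>U\<close> in the half-open interval from the
  preceding point of \<open>Q\<close> to \<open>q\<close>. Finiteness of \<open>Q\<close> makes the
  removed union closed.\<close>

lemma disjoint_clopen_neighbourhoods:
  assumes W: "Well_order r" and Q: "finite Q" "Q \<subseteq> U"
    and U: "openin (ord_topology r) U" "closedin (ord_topology r) U"
  obtains N where "\<And>q. q \<in> Q \<Longrightarrow> openin (ord_topology r) (N q)"
    "\<And>q. q \<in> Q \<Longrightarrow> closedin (ord_topology r) (N q)"
    "\<And>q. q \<in> Q \<Longrightarrow> q \<in> N q" "\<And>q. q \<in> Q \<Longrightarrow> N q \<subseteq> U"
    "\<And>p q. p \<in> Q \<Longrightarrow> q \<in> Q \<Longrightarrow> p \<noteq> q \<Longrightarrow> N p \<inter> N q = {}"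
proof -
  interpret r: wo_rel r by (simp add: wo_rel_def W)
  define N where "N q = U \<inter> under r q - (\<Union>p \<in> Q \<inter> underS r q. under r p)" for q
  have UF: "U \<subseteq> Field r" using openin_subset[OF U(1)] by simp
  then have F: "q \<in> Field r" if "q \<in> Q" for q using Q that by blast
  have fin: "finite (under r ` (Q \<inter> underS r q))" for q using Q by simp
  show thesis
  proof
    fix q assume q: "q \<in> Q"
    show "openin (ord_topology r) (N q)" unfolding N_def
      using U clopen_under[OF W] F q fin
      by (intro openin_diff openin_Int closedin_Union) auto
    show "closedin (ord_topology r) (N q)" unfolding N_def
      using U clopen_under[OF W] F q
      by (intro closedin_diff closedin_Int openin_Union) auto
    show "q \<in> N q"
      using q Q F[OF q] r.REFL r.ANTISYM
      by (auto simp: N_def under_def underS_def refl_on_def dest: antisymD)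
    show "N q \<subseteq> U" by (auto simp: N_def)
  next
    have *: "N p \<inter> N q = {}" if "p \<in> Q" "p \<in> underS r q" for p q
      using that by (auto simp: N_def)
    fix p q assume "p \<in> Q" "q \<in> Q" "p \<noteq> q"
    moreover from this have "p \<in> underS r q \<or> q \<in> underS r p"
      using F r.TOTALS by (auto simp: underS_def)
    ultimately show "N p \<inter> N q = {}" using * by blast
  qed
qed

text \<open>
  Here \<open>G A\<close> stands for \<open>h (y A) - h (y (L - A))\<close>. The rank \<open>\<rho>\<close> may exceed the Cantor--Bendixson
  rank, and \<open>P \<eta>\<close> may contain only some of the points of rank \<open>\<eta>\<close>.
\<close>
lemma rank_transfer:
  fixes \<rho> :: "'k \<Rightarrow> 'w" and G :: "'l set \<Rightarrow> 'k \<Rightarrow> real"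
  assumes W: "Well_order w" and r: "Well_order r" and Y: "compact_space Y"
    and \<rho>: "\<And>t. t \<in> topspace Y \<Longrightarrow> \<rho> t \<in> Field w"
    and isolated: "\<And>t. t \<in> topspace Y \<Longrightarrow>
      \<exists>V. openin Y V \<and> t \<in> V \<and> (\<forall>s \<in> V - {t}. \<rho> s \<in> underS w (\<rho> t))"
    and accum: "\<And>\<beta> p U \<beta>'. p \<in> P \<beta> \<Longrightarrow> openin (ord_topology r) U \<Longrightarrow> p \<in> U \<Longrightarrow>
      \<beta>' \<in> underS w \<beta> \<Longrightarrow> infinite (U \<inter> P \<beta>')"
    and G: "\<And>A. openin (ord_topology r) A \<Longrightarrow> closedin (ord_topology r) A \<Longrightarrow>
      continuous_map Y euclideanreal (G A)"
    and G_compl: "\<And>A t. A \<subseteq> Field r \<Longrightarrow> G (Field r - A) t = - G A t"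
    and \<delta>: "\<delta> > 0"
    and sep: "\<And>U. openin (ord_topology r) U \<Longrightarrow> closedin (ord_topology r) U \<Longrightarrow> U \<noteq> {} \<Longrightarrow>
      \<exists>t \<in> topspace Y. \<exists>s \<in> {1, -1}. \<forall>A. openin (ord_topology r) A \<longrightarrow>
        closedin (ord_topology r) A \<longrightarrow> U \<subseteq> A \<longrightarrow> \<delta> \<le> s * G A t"
    and "\<beta> \<in> Field w" "p \<in> P \<beta>" "openin (ord_topology r) U" "closedin (ord_topology r) U" "p \<in> U"
  shows "\<exists>t \<in> topspace Y. (\<beta>, \<rho> t) \<in> w \<and> (\<exists>s \<in> {1, -1}. \<forall>A. openin (ord_topology r) A \<longrightarrow>
        closedin (ord_topology r) A \<longrightarrow> U \<subseteq> A \<longrightarrow> \<delta> \<le> s * G A t)"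
proof -
  interpret w: wo_rel w by (simp add: wo_rel_def W)
  define clo where "clo A \<longleftrightarrow> openin (ord_topology r) A \<and> closedin (ord_topology r) A" for A
  \<comment> \<open>The sign is fixed before \<open>A\<close> varies. So \<open>T U\<close> is a
    union of two intersections of closed sets, and one pair of point and sign can later be tested on
    a set and on its complement.\<close>
  define T where "T U = {t \<in> topspace Y. \<exists>s \<in> {1, -1}. \<forall>A. clo A \<longrightarrow> U \<subseteq> A \<longrightarrow> \<delta> \<le> s * G A t}" for U
  have T_closed: "closedin Y (T U)" if U: "clo U" for U
  proof -
    have "closedin Y {t \<in> topspace Y. s * G A t \<in> {\<delta>..}}" if "clo A" for s A
      using that G by (intro closedin_continuous_map_preimage[where Y = euclideanreal]
        continuous_map_real_mult continuous_map_const[THEN iffD2]) (auto simp: clo_def)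
    then have *: "closedin Y (\<Inter>A \<in> {A. clo A \<and> U \<subseteq> A}. {t \<in> topspace Y. s * G A t \<in> {\<delta>..}})" for s
      using U by (intro closedin_Inter) auto
    then have "closedin Y (\<Union>s \<in> {1, -1}. \<Inter>A \<in> {A. clo A \<and> U \<subseteq> A}.
        {t \<in> topspace Y. s * G A t \<in> {\<delta>..}})"
      by (intro closedin_Union) (use * in blast)+
    moreover have "T U = (\<Union>s \<in> {1, -1}. \<Inter>A \<in> {A. clo A \<and> U \<subseteq> A}.
        {t \<in> topspace Y. s * G A t \<in> {\<delta>..}})"
      using U by (auto simp: T_def)
    ultimately show ?thesis by simp
  qed
  have "\<exists>t \<in> T U. (\<beta>, \<rho> t) \<in> w" if "\<beta> \<in> Field w" "p \<in> P \<beta>" "clo U" "p \<in> U" for \<beta> p U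
    using w.WF that
  proof (induction \<beta> arbitrary: p U rule: wf_induct_rule)
    case (less \<beta>)
    have "compactin Y (T U)" using closedin_compact_space[OF Y T_closed[OF less.prems(3)]] .
    have TY: "T U \<subseteq> topspace Y" by (auto simp: T_def)
    then have "\<forall>t \<in> T U. \<exists>V. openin Y V \<and> t \<in> V \<and> (\<forall>s \<in> V - {t}. \<rho> s \<in> underS w (\<rho> t))"
      using isolated by blast
    then obtain V where V: "\<And>t. t \<in> T U \<Longrightarrow> openin Y (V t)" "\<And>t. t \<in> T U \<Longrightarrow> t \<in> V t"
      "\<And>t s. t \<in> T U \<Longrightarrow> s \<in> V t \<Longrightarrow> s \<noteq> t \<Longrightarrow> \<rho> s \<in> underS w (\<rho> t)"
      by (metis DiffI singletonD)
    have "\<exists>F. finite F \<and> F \<subseteq> V ` T U \<and> T U \<subseteq> \<Union>F"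
      using \<open>compactin Y (T U)\<close> V(1,2) unfolding compactin_def by (elim conjE allE[of _ "V ` T U"]) blast
    \<comment> \<open>Near each point of \<open>T U\<close> all other points have smaller rank, so
      the centres \<open>F\<close> of a finite subcover are the only candidates for the largest
      rank.\<close>
    then obtain F where F: "finite F" "F \<subseteq> T U" "T U \<subseteq> \<Union>(V ` F)"
      by (metis finite_subset_image)
    have "T U \<noteq> {}"
      using sep[of U] less.prems(3,4) unfolding T_def clo_def by blast
    with F have "F \<noteq> {}" by auto
    have "\<rho> ` F \<subseteq> Field w" using F(2) TY \<rho> by blast
    from finite_has_max[OF W _ _ this] F(1) \<open>F \<noteq> {}\<close> obtain t0
      where t0: "t0 \<in> F" "\<And>t. t \<in> F \<Longrightarrow> (\<rho> t, \<rho> t0) \<in> w" by auto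
    define \<mu> where "\<mu> = \<rho> t0"
    have \<mu>: "\<mu> \<in> Field w" using t0(1) \<open>\<rho> ` F \<subseteq> Field w\<close> by (auto simp: \<mu>_def)
    \<comment> \<open>No rank on \<open>T U\<close> exceeds \<open>\<mu>\<close>, and \<open>\<mu>\<close> is attained only finitely often.\<close>
    have inF: "t \<in> F" if t: "t \<in> T U" "(\<mu>, \<rho> t) \<in> w" for t
    proof -
      obtain u where u: "u \<in> F" "t \<in> V u" using F(3) t(1) by blast
      show ?thesis
      proof (cases "t = u")
        case False
        then have "\<rho> t \<in> underS w (\<rho> u)" using V(3) u F(2) by blast
        then have "(\<rho> t, \<rho> u) \<in> w" "\<rho> t \<noteq> \<rho> u" by (auto simp: underS_def)
        moreover have "(\<rho> u, \<rho> t) \<in> w"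
          using t0(2)[OF u(1)] t(2) w.TRANS by (auto simp: \<mu>_def dest: transD)
        ultimately show ?thesis using w.ANTISYM by (auto dest: antisymD)
      qed (use u in simp)
    qed
    show ?case
    proof (cases "(\<beta>, \<mu>) \<in> w")
      case True
      then show ?thesis using t0(1) F(2) by (auto simp: \<mu>_def)
    next
      case False
      then have \<mu>\<beta>: "\<mu> \<in> underS w \<beta>"
        using w.TOTALS w.REFL \<mu> less.prems(1) by (auto simp: underS_def refl_on_def)
      then have "infinite (U \<inter> P \<mu>)"
        using accum less.prems(2-4) by (auto simp: clo_def)
      \<comment> \<open>One more point than there are pairs of a point of \<open>F\<close> and a
        sign, for the pigeonhole principle below.\<close>
      then obtain Q where Q: "finite Q" "card Q = 2 * card F + 1" "Q \<subseteq> U \<inter> P \<mu>"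
        using infinite_arbitrarily_large by blast
      obtain N where N: "\<And>q. q \<in> Q \<Longrightarrow> clo (N q)" "\<And>q. q \<in> Q \<Longrightarrow> q \<in> N q"
        "\<And>q. q \<in> Q \<Longrightarrow> N q \<subseteq> U" "\<And>p q. p \<in> Q \<Longrightarrow> q \<in> Q \<Longrightarrow> p \<noteq> q \<Longrightarrow> N p \<inter> N q = {}"
        using disjoint_clopen_neighbourhoods[OF r Q(1), of U] Q(3) less.prems(3)
        unfolding clo_def by (metis le_inf_iff)
      \<comment> \<open>The induction hypothesis at \<open>\<mu>\<close> gives a point of
        \<open>T (N q)\<close> of rank at least \<open>\<mu>\<close>. It lies in \<open>T U\<close>
        because \<open>N q\<close> is contained in \<open>U\<close>, and hence in
        \<open>F\<close>.\<close>
      have "\<exists>ts. ts \<in> F \<times> {1, -1} \<and> (\<forall>A. clo A \<longrightarrow> N q \<subseteq> A \<longrightarrow> \<delta> \<le> snd ts * G A (fst ts))"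
        if q: "q \<in> Q" for q
      proof -
        have "\<exists>t \<in> T (N q). (\<mu>, \<rho> t) \<in> w"
          using less.IH[of \<mu> q "N q"] \<mu>\<beta> \<mu> N(1,2)[OF q] Q(3) q by (auto simp: underS_def)
        then obtain t where t: "t \<in> T (N q)" "(\<mu>, \<rho> t) \<in> w" by blast
        have "t \<in> T U" using t(1) N(3)[OF q] unfolding T_def by blast
        then have "t \<in> F" using inF t(2) by blast
        from t(1) obtain s where "s \<in> {1, -1}" "\<forall>A. clo A \<longrightarrow> N q \<subseteq> A \<longrightarrow> \<delta> \<le> s * G A t"
          unfolding T_def by blast
        with \<open>t \<in> F\<close> show ?thesis by (intro exI[of _ "(t, s)"]) auto
      qed
      then obtain \<tau> where \<tau>: "\<And>q. q \<in> Q \<Longrightarrow> \<tau> q \<in> F \<times> {1, -1}"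
        "\<And>q A. q \<in> Q \<Longrightarrow> clo A \<Longrightarrow> N q \<subseteq> A \<Longrightarrow> \<delta> \<le> snd (\<tau> q) * G A (fst (\<tau> q))"
        by metis
      have "card (F \<times> {1, -1 :: real}) = 2 * card F"
        by (simp add: card_cartesian_product)
      then have "\<not> inj_on \<tau> Q"
        using card_inj_on_le[of \<tau> Q "F \<times> {1, -1}"] \<tau>(1) F(1) Q(2) by fastforce
      then obtain p q where pq: "p \<in> Q" "q \<in> Q" "\<tau> p = \<tau> q" "p \<noteq> q"
        unfolding inj_on_def by blast
      have sub: "N p \<subseteq> Field r" "N q \<subseteq> Field r"
        using N(1)[OF pq(1)] N(1)[OF pq(2)] openin_subset unfolding clo_def by fastforce+
      \<comment> \<open>\<open>p\<close> and \<open>q\<close> share point and sign. This sign works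
        for \<open>N p\<close> and also for its complement, which contains \<open>N q\<close>; but
        \<open>G\<close> changes sign between the two.\<close>
      have "clo (Field r - N p)"
        using N(1)[OF pq(1)] unfolding clo_def
        by (metis closedin_def openin_closedin_eq topspace_ord_topology)
      moreover have "N q \<subseteq> Field r - N p" using N(4)[OF pq(1,2,4)] sub by blast
      ultimately have "\<delta> \<le> - (snd (\<tau> q) * G (N p) (fst (\<tau> q)))"
        using \<tau>(2)[OF pq(2)] G_compl[OF sub(1)] by fastforce
      moreover have "\<delta> \<le> snd (\<tau> q) * G (N p) (fst (\<tau> q))"
        using \<tau>(2)[OF pq(1) N(1)[OF pq(1)]] pq(3) by auto
      ultimately show ?thesis using \<delta> by linarith
    qed
  qed
  from this[of \<beta> p U] assms(11-) show ?thesis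
    by (auto simp: T_def clo_def)
qed


section \<open>Coarse maps between spaces of continuous functions\<close>

definition clopen_step :: "'a rel \<Rightarrow> real \<Rightarrow> real \<Rightarrow> 'a option set \<Rightarrow> 'a option \<Rightarrow> real" where
  "clopen_step \<beta> c d A = restrict (\<lambda>x. if x \<in> A then c else d) (Field (ord_succ \<beta>))"

text \<open>Each preimage is empty, \<open>A\<close>, its complement or the whole interval, and all
  of these are open.\<close>

lemma clopen_step_in_mspace:
  assumes "Well_order \<beta>"
    and A: "openin (ord_topology (ord_succ \<beta>)) A" "closedin (ord_topology (ord_succ \<beta>)) A"
  shows "clopen_step \<beta> c d A \<in> mspace (C_interval \<beta>)"
proof -
  let ?X = "ord_topology (ord_succ \<beta>)"
  have "openin ?X {x \<in> topspace ?X. clopen_step \<beta> c d A x \<in> V}" for V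
  proof -
    have "{x \<in> topspace ?X. clopen_step \<beta> c d A x \<in> V} =
      (if c \<in> V then A else {}) \<union> (if d \<in> V then topspace ?X - A else {})"
      using openin_subset[OF A(1)] by (auto simp: clopen_step_def)
    moreover have "openin ?X (topspace ?X - A)" using A(2) by (simp add: closedin_def)
    ultimately show ?thesis using A(1) by (simp only: openin_Un openin_empty split: if_split) simp
  qed
  then have "continuous_map ?X euclideanreal (clopen_step \<beta> c d A)"
    by (auto simp: continuous_map_def)
  then show ?thesis
    by (simp add: mspace_C_interval[OF assms(1)]) (simp add: clopen_step_def)
qed

lemma mdist_C_interval_le_iff:
  assumes "f \<in> mspace (C_interval \<beta>)" "g \<in> mspace (C_interval \<beta>)"
  shows "mdist (C_interval \<beta>) f g \<le> a \<longleftrightarrow> (\<forall>x \<in> Field (ord_succ \<beta>). \<bar>f x - g x\<bar> \<le> a)"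
proof -
  have "topspace (ord_topology (ord_succ \<beta>)) \<noteq> {}"
    by (simp add: Field_ord_succ)
  from cfunspace_mdist_le[OF assms[unfolded C_interval_def] this] show ?thesis
    by (simp add: C_interval_def dist_real_def)
qed

text \<open>This applies \<open>rank_transfer\<close> with \<open>\<delta> = 1\<close> and the whole
  interval as \<open>U\<close>. The separation assumed there comes from \<open>c < 2 * a\<close>:
  for large \<open>R\<close> the guaranteed gap of about \<open>4 * a * R\<close> beats two errors
  of about \<open>c * R\<close>, whatever \<open>b\<close> is.\<close>

lemma coarse_rank_transfer:
  fixes \<rho> :: "'k option \<Rightarrow> 'w" and h :: "('l option \<Rightarrow> real) \<Rightarrow> 'k option \<Rightarrow> real"
  assumes w: "Well_order w" and W: "Well_order \<beta>" "Well_order \<kappa>"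
    and h: "h \<in> mspace (C_interval \<beta>) \<rightarrow> mspace (C_interval \<kappa>)"
    and lower: "\<And>x y. x \<in> mspace (C_interval \<beta>) \<Longrightarrow> y \<in> mspace (C_interval \<beta>) \<Longrightarrow>
      a * mdist (C_interval \<beta>) x y - b \<le> mdist (C_interval \<kappa>) (h x) (h y)"
    and upper: "\<And>x y. x \<in> mspace (C_interval \<beta>) \<Longrightarrow> y \<in> mspace (C_interval \<beta>) \<Longrightarrow>
      mdist (C_interval \<kappa>) (h x) (h y) \<le> c * mdist (C_interval \<beta>) x y + b"
    and pos: "0 < a" "0 < c" "0 \<le> b" and c: "c < 2 * a"
    and \<rho>: "\<And>t. t \<in> Field (ord_succ \<kappa>) \<Longrightarrow> \<rho> t \<in> Field w"
    and isolated: "\<And>t. t \<in> Field (ord_succ \<kappa>) \<Longrightarrow>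
      \<exists>V. openin (ord_topology (ord_succ \<kappa>)) V \<and> t \<in> V \<and> (\<forall>s \<in> V - {t}. \<rho> s \<in> underS w (\<rho> t))"
    and accum: "\<And>\<eta> p U \<eta>'. p \<in> P \<eta> \<Longrightarrow> openin (ord_topology (ord_succ \<beta>)) U \<Longrightarrow> p \<in> U \<Longrightarrow>
      \<eta>' \<in> underS w \<eta> \<Longrightarrow> infinite (U \<inter> P \<eta>')"
    and \<eta>: "\<eta> \<in> Field w" "p \<in> P \<eta>" "p \<in> Field (ord_succ \<beta>)"
  shows "\<exists>t \<in> Field (ord_succ \<kappa>). (\<eta>, \<rho> t) \<in> w"
proof -
  let ?L = "Field (ord_succ \<beta>)" and ?X = "ord_topology (ord_succ \<beta>)"
    and ?Y = "ord_topology (ord_succ \<kappa>)"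
  \<comment> \<open>Chosen so that \<open>4 * a * R - b\<close> exceeds
    \<open>2 * (c * R + b)\<close> by 2: the lower bound for functions at distance
    \<open>4 * R\<close> against two upper bounds for functions at distance
    \<open>R\<close>.\<close>
  define R where "R = (3 * b + 2) / (4 * a - 2 * c)"
  have R: "R > 0" using pos c by (simp add: R_def)
  have "(4 * a - 2 * c) * R = 3 * b + 2" using c by (simp add: R_def)
  then have gap: "4 * a * R - b > 2 * (c * R + b) + 1" by (simp add: algebra_simps)
  define y where "y = clopen_step \<beta> R (- R)"
  define G where "G A t = h (y A) t - h (y (?L - A)) t" for A t
  have compl: "openin ?X (?L - A)" "closedin ?X (?L - A)" if "openin ?X A" "closedin ?X A" for A
    using that by (metis closedin_def topspace_ord_topology)
      (use that in \<open>metis openin_closedin_eq topspace_ord_topology\<close>)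
  have y: "y A \<in> mspace (C_interval \<beta>)" if "openin ?X A" "closedin ?X A" for A
    unfolding y_def using clopen_step_in_mspace[OF W(1) that] .
  have "\<exists>t \<in> topspace ?Y. (\<eta>, \<rho> t) \<in> w \<and> (\<exists>s \<in> {1, -1}. \<forall>A. openin ?X A \<longrightarrow>
        closedin ?X A \<longrightarrow> topspace ?X \<subseteq> A \<longrightarrow> 1 \<le> s * G A t)"
  proof (rule rank_transfer[OF w Well_order_ord_succ[OF W(1)] compact_space_ord_succ[OF W(2)],
        where P = P])
    show "continuous_map ?Y euclideanreal (G A)" if "openin ?X A" "closedin ?X A" for A
    proof -
      have "h (y A) \<in> mspace (C_interval \<kappa>)" "h (y (?L - A)) \<in> mspace (C_interval \<kappa>)"
        using h y compl that by blast+
      then show ?thesis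
        unfolding G_def mspace_C_interval[OF W(2)] by (auto intro: continuous_map_diff)
    qed
    show "G (?L - A) t = - G A t" if "A \<subseteq> ?L" for A t
      using that by (simp add: G_def double_diff)
    show "\<exists>t \<in> topspace ?Y. \<exists>s \<in> {1, -1}. \<forall>A. openin ?X A \<longrightarrow> closedin ?X A \<longrightarrow> U \<subseteq> A \<longrightarrow>
        1 \<le> s * G A t" if U: "openin ?X U" "closedin ?X U" "U \<noteq> {}" for U
    proof -
      \<comment> \<open>These functions do not depend on \<open>A\<close>, so neither do the point
        \<open>t\<close> and the sign \<open>s\<close> found from them.\<close>
      define x x' where "x = clopen_step \<beta> (2 * R) 0 U" and "x' = clopen_step \<beta> (- 2 * R) 0 U"
      have x: "x \<in> mspace (C_interval \<beta>)" "x' \<in> mspace (C_interval \<beta>)"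
        unfolding x_def x'_def using clopen_step_in_mspace[OF W(1) U(1,2)] by auto
      have hx: "h x \<in> mspace (C_interval \<kappa>)" "h x' \<in> mspace (C_interval \<kappa>)"
        using h x by auto
      have UL: "U \<subseteq> ?L" using openin_subset[OF U(1)] by simp
      obtain u where u: "u \<in> U" using U(3) by blast
      have "\<bar>x u - x' u\<bar> \<le> mdist (C_interval \<beta>) x x'"
        using mdist_C_interval_le_iff[OF x] u UL by blast
      then have "4 * R \<le> mdist (C_interval \<beta>) x x'"
        using u UL R by (auto simp: x_def x'_def clopen_step_def)
      then have "a * (4 * R) \<le> a * mdist (C_interval \<beta>) x x'"
        using pos(1) by simp
      then have "\<not> mdist (C_interval \<kappa>) (h x) (h x') \<le> 2 * (c * R + b) + 1"
        using lower[OF x] gap by simp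
      then obtain t where t: "t \<in> Field (ord_succ \<kappa>)" "\<bar>h x t - h x' t\<bar> > 2 * (c * R + b) + 1"
        unfolding mdist_C_interval_le_iff[OF hx] by (auto simp: not_le)
      define s where "s = (if h x t \<ge> h x' t then 1 else -1 :: real)"
      have "1 \<le> s * G A t" if A: "openin ?X A" "closedin ?X A" "U \<subseteq> A" for A
      proof -
        have near: "\<bar>h z t - h z' t\<bar> \<le> c * R + b"
          if "z \<in> mspace (C_interval \<beta>)" "z' \<in> mspace (C_interval \<beta>)"
            "\<forall>q \<in> ?L. \<bar>z q - z' q\<bar> \<le> R" for z z'
        proof -
          have "mdist (C_interval \<beta>) z z' \<le> R" using mdist_C_interval_le_iff that by blast
          then have "c * mdist (C_interval \<beta>) z z' \<le> c * R" using pos(2) by simp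
          then have "mdist (C_interval \<kappa>) (h z) (h z') \<le> c * R + b"
            using upper[OF that(1,2)] by linarith
          moreover have "h z \<in> mspace (C_interval \<kappa>)" "h z' \<in> mspace (C_interval \<kappa>)"
            using h that by auto
          ultimately show ?thesis using t(1) mdist_C_interval_le_iff by blast
        qed
        \<comment> \<open>The values of \<open>x\<close> and \<open>y A\<close> are
          \<open>2 * R\<close> and \<open>R\<close> on \<open>U\<close>, \<open>0\<close> and
          \<open>R\<close> on the rest of \<open>A\<close>, \<open>0\<close> and \<open>- R\<close>
          elsewhere. The next estimate is the same with signs reversed.\<close>
        have "\<bar>h x t - h (y A) t\<bar> \<le> c * R + b"
          using A R by (intro near x y) (auto simp: x_def y_def clopen_step_def)
        moreover have "\<bar>h x' t - h (y (?L - A)) t\<bar> \<le> c * R + b"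
          using A R by (intro near x y compl) (auto simp: x'_def y_def clopen_step_def)
        ultimately show ?thesis
          using t(2) by (auto simp: s_def G_def abs_if split: if_splits)
      qed
      moreover have "s \<in> {1, -1}" by (simp add: s_def)
      ultimately show ?thesis using t(1) unfolding topspace_ord_topology by blast
    qed
    show "openin ?X (topspace ?X)" "closedin ?X (topspace ?X)"
      by (rule openin_topspace closedin_topspace)+
    show "p \<in> topspace ?X" using \<eta>(3) by simp
  qed (use \<rho> isolated accum \<eta> in \<open>simp_all\<close>)
  then show ?thesis by auto
qed

section \<open>The rank of a point in Cantor normal form\<close>

text \<open>The least exponent in the Cantor normal form. For the zero function the value is
  unspecified, which is why \<open>cb_rank\<close> treats that case separately.\<close>

definition min_support :: "'a rel \<Rightarrow> ('a \<Rightarrow> nat) \<Rightarrow> 'a" where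
  "min_support r f = wo_rel.minim r {a. f a \<noteq> 0}"

lemma min_support:
  assumes "Well_order r" "f \<in> omega_pow_funs r" "f a \<noteq> 0"
  shows "f (min_support r f) \<noteq> 0" "(min_support r f, a) \<in> r"
proof -
  interpret r: wo_rel r by (simp add: wo_rel_def assms)
  have "{a. f a \<noteq> 0} \<subseteq> Field r" "{a. f a \<noteq> 0} \<noteq> {}"
    using assms by (auto simp: omega_pow_funs_def)
  from r.minim_in[OF this] r.minim_least[OF this(1), of a] assms(3)
  show "f (min_support r f) \<noteq> 0" "(min_support r f, a) \<in> r"
    by (auto simp: min_support_def)
qed

text \<open>
  A point \<open>\<omega>\<^sup>r \<cdot> i + f\<close> has as rank its least exponent. The isolated point \<open>0\<close> also receives the top
  rank; this is harmless, as ranks only have to drop near each point.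
\<close>
fun cb_rank :: "'a rel \<Rightarrow> (('a \<Rightarrow> nat) \<times> nat) option \<Rightarrow> 'a option" where
  "cb_rank r None = None"
| "cb_rank r (Some (f, i)) = (if f = (\<lambda>_. 0) then None else Some (min_support r f))"

lemma zero_in_omega_pow_funs: "(\<lambda>_. 0) \<in> omega_pow_funs r"
  by (simp add: omega_pow_funs_def)

lemma omega_pow_le_zero:
  assumes "(f, \<lambda>_. 0) \<in> omega_pow r"
  shows "f = (\<lambda>_. 0)"
  using assms by (auto simp: omega_pow_def)

lemma ord_mult_natLeq_on_iff:
  "((f, i), (g, j)) \<in> ord_mult (omega_pow r) (natLeq_on n) \<longleftrightarrow>
    f \<in> omega_pow_funs r \<and> g \<in> omega_pow_funs r \<and> i < n \<and> j < n \<and>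
    (i < j \<or> i = j \<and> (f, g) \<in> omega_pow r)"
  by (auto simp: ord_mult_def Field_omega_pow)

lemma Field_omega_pow_mult:
  assumes "Well_order r"
  shows "Field (ord_mult (omega_pow r) (natLeq_on n)) = omega_pow_funs r \<times> {..<n}"
  using Field_ord_mult[OF Well_order_omega_pow[OF assms] natLeq_on_Well_order]
  by (auto simp: Field_omega_pow Field_natLeq_on)

lemma ord_succ_Some_iff [simp]: "(Some x, Some y) \<in> ord_succ r \<longleftrightarrow> (x, y) \<in> r"
  by (auto simp: ord_succ_def)

lemma ord_succ_None_iff [simp]: "(Some x, None) \<in> ord_succ r \<longleftrightarrow> x \<in> Field r"
  "(None, None) \<in> ord_succ r" "(None, Some x) \<notin> ord_succ r"
  by (auto simp: ord_succ_def)

text \<open>Here \<open>f(a := f a - 1)\<close> is \<open>f\<close> with one copy of its last term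
  \<open>\<omega>\<^sup>a\<close> removed. An ordinal strictly between the two arises from it by
  adding a nonzero ordinal below \<open>\<omega>\<^sup>a\<close>, so its least exponent is below
  \<open>a\<close>.\<close>

lemma min_support_less:
  assumes r: "Well_order r" and f: "f \<in> omega_pow_funs r" "f a \<noteq> 0"
    and least: "\<And>b. f b \<noteq> 0 \<Longrightarrow> (a, b) \<in> r"
    and g: "(f(a := f a - 1), g) \<in> omega_pow r" "g \<noteq> f(a := f a - 1)"
      "(g, f) \<in> omega_pow r" "g \<noteq> f"
  shows "g \<noteq> (\<lambda>_. 0)" "min_support r g \<in> underS r a"
proof -
  interpret r: wo_rel r by (simp add: wo_rel_def r)
  have gF: "g \<in> omega_pow_funs r" using g(1) by (simp add: omega_pow_def)
  \<comment> \<open>\<open>c\<close> is the largest place where \<open>g\<close> differs from the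
    shortened function, and \<open>d\<close> the largest place where it differs from
    \<open>f\<close>.\<close>
  obtain c where c: "(f(a := f a - 1)) c < g c" "\<And>b. b \<in> aboveS r c \<Longrightarrow> (f(a := f a - 1)) b = g b"
    using g(1,2) by (auto simp: omega_pow_def)
  obtain d where d: "g d < f d" "\<And>b. b \<in> aboveS r d \<Longrightarrow> g b = f b"
    using g(3,4) by (auto simp: omega_pow_def)
  have "f a \<noteq> 0" "g c \<noteq> 0" "f d \<noteq> 0" using f(2) c(1) d(1) by simp_all
  then have F: "a \<in> Field r" "c \<in> Field r" "d \<in> Field r"
    using f(1) gF by (auto simp: omega_pow_funs_def)
  have ad: "(a, d) \<in> r" using least d(1) by simp
  have "c \<in> underS r a"
  proof (rule ccontr)
    assume "c \<notin> underS r a"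
    then have ac: "(a, c) \<in> r" using F r.TOTALS r.REFL by (auto simp: underS_def refl_on_def)
    \<comment> \<open>If \<open>c = d\<close>, then \<open>g c\<close> lies strictly between two
      values that differ by at most 1. Otherwise the larger of \<open>c\<close> and \<open>d\<close>
      is not \<open>a\<close>, so \<open>f\<close> and the shortened function agree there, while
      only one of them agrees with \<open>g\<close>.\<close>
    consider "c = d" | "c \<in> aboveS r d" | "d \<in> aboveS r c"
      using F r.TOTALS by (auto simp: aboveS_def)
    then show False
    proof cases
      case 1
      then show False using c(1) d(1) by (auto split: if_splits)
    next
      case 2
      then have "c \<noteq> a" using ad r.ANTISYM by (auto simp: aboveS_def dest: antisymD)
      then show False using c(1) d(2)[OF 2] by simp
    next
      case 3
      then have "d \<noteq> a" using ac r.ANTISYM by (auto simp: aboveS_def dest: antisymD)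
      then show False using d(1) c(2)[OF 3] by simp
    qed
  qed
  then show "min_support r g \<in> underS r a"
    using min_support(2)[OF r gF \<open>g c \<noteq> 0\<close>] r.TRANS r.ANTISYM
    by (auto simp: underS_def dest: transD antisymD)
  show "g \<noteq> (\<lambda>_. 0)" using \<open>g c \<noteq> 0\<close> by auto
qed

text \<open>For \<open>t\<close> other than 0 an interval \<open>(u, t]\<close> works:
  \<open>u\<close> is the preceding multiple if \<open>t\<close> is a multiple of
  \<open>\<omega>\<^sup>r\<close>, and otherwise \<open>t\<close> with one copy of its last term
  removed. The point 0 is open by itself.\<close>

lemma cb_rank_isolated:
  assumes r: "Well_order r" and n: "n \<ge> 1"
    and t: "t \<in> Field (ord_succ (ord_mult (omega_pow r) (natLeq_on n)))"
  shows "\<exists>V. openin (ord_topology (ord_succ (ord_mult (omega_pow r) (natLeq_on n)))) V \<and> t \<in> V \<and>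
    (\<forall>s \<in> V - {t}. cb_rank r s \<in> underS (ord_succ r) (cb_rank r t))"
proof -
  interpret r: wo_rel r by (simp add: wo_rel_def r)
  let ?m = "ord_mult (omega_pow r) (natLeq_on n)"
  let ?k = "ord_succ ?m"
  have W: "Well_order ?k"
    by (intro Well_order_ord_succ Well_order_ord_mult Well_order_omega_pow r natLeq_on_Well_order)
  interpret k: wo_rel ?k by (simp add: wo_rel_def W)
  have F: "Field ?k = insert None (Some ` (omega_pow_funs r \<times> {..<n}))"
    by (simp add: Field_ord_succ Field_omega_pow_mult[OF r])
  have tt: "t \<in> under ?k t" using t k.REFL by (auto simp: under_def refl_on_def)
  have below: ?thesis
    if u: "u \<in> underS ?k t" and *: "\<And>s. (u, s) \<in> ?k \<Longrightarrow> s \<noteq> u \<Longrightarrow> (s, t) \<in> ?k \<Longrightarrow> s \<noteq> t \<Longrightarrow>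
      cb_rank r s \<in> underS (ord_succ r) (cb_rank r t)" for u
  proof (intro exI conjI ballI)
    have "u \<in> Field ?k" using u by (auto simp: underS_def intro: FieldI1)
    then show "openin (ord_topology ?k) (aboveS ?k u \<inter> under ?k t)"
      by (intro openin_Int openin_ord_topology_rays clopen_under[OF W t])
    show "t \<in> aboveS ?k u \<inter> under ?k t" using u tt by (auto simp: aboveS_def underS_def)
    show "cb_rank r s \<in> underS (ord_succ r) (cb_rank r t)"
      if "s \<in> aboveS ?k u \<inter> under ?k t - {t}" for s
      using that by (intro *) (auto simp: aboveS_def under_def)
  qed
  have lt_top: "cb_rank r (Some (g, j)) \<in> underS (ord_succ r) None"
    if "g \<in> omega_pow_funs r" "g \<noteq> (\<lambda>_. 0)" for g j
  proof -
    obtain a where "g a \<noteq> 0" using \<open>g \<noteq> (\<lambda>_. 0)\<close> by auto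
    from min_support(2)[OF r that(1) this] have "min_support r g \<in> Field r" by (rule FieldI1)
    with that show ?thesis by (simp add: underS_def)
  qed
  have zero_le: "((\<lambda>_. 0), g) \<in> omega_pow r" if "g \<in> omega_pow_funs r" for g
  proof (cases "g = (\<lambda>_. 0)")
    case False
    then have "(g, \<lambda>_. 0) \<notin> omega_pow r" using omega_pow_le_zero by blast
    moreover have "wo_rel (omega_pow r)" by (simp add: wo_rel_def Well_order_omega_pow r)
    ultimately show ?thesis
      using wo_rel.TOTALS that zero_in_omega_pow_funs unfolding Field_omega_pow[symmetric] by metis
  qed (auto simp: omega_pow_def zero_in_omega_pow_funs)
  show ?thesis
  proof (cases t)
    case None
    \<comment> \<open>The copies of \<open>\<omega>\<^sup>r\<close> are numbered from 0, so this is
      the start of the last one.\<close>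
    have u: "Some (\<lambda>_. 0, n - 1) \<in> underS ?k t"
      using None n by (auto simp: underS_def Field_omega_pow_mult[OF r] zero_in_omega_pow_funs)
    show ?thesis
    proof (rule below[OF u])
      fix s assume s: "(Some (\<lambda>_. 0, n - 1), s) \<in> ?k" "s \<noteq> Some (\<lambda>_. 0, n - 1)" "s \<noteq> t"
      then obtain g j where g: "s = Some (g, j)" using None by (cases s) auto
      with s have "j = n - 1" "g \<in> omega_pow_funs r" by (auto simp: ord_mult_natLeq_on_iff)
      with s g None show "cb_rank r s \<in> underS (ord_succ r) (cb_rank r t)"
        using lt_top[of g j] by auto
    qed
  next
    case (Some fi)
    obtain f i where fi: "fi = (f, i)" by force
    with Some t F have f: "f \<in> omega_pow_funs r" "i < n" by auto
    note Some = Some[unfolded fi]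
    show ?thesis
    proof (cases "f = (\<lambda>_. 0)")
      case zero: True
      show ?thesis
      proof (cases i)
        case 0
        have "s = t" if "s \<in> under ?k t" for s
          using that Some zero 0
          by (cases s) (auto simp: under_def ord_mult_natLeq_on_iff dest: omega_pow_le_zero)
        then show ?thesis using clopen_under(1)[OF W t] tt by blast
      next
        case (Suc i')
        have u: "Some (\<lambda>_. 0, i') \<in> underS ?k t"
          using Some Suc f by (auto simp: underS_def ord_mult_natLeq_on_iff zero_in_omega_pow_funs)
        show ?thesis
        proof (rule below[OF u])
          fix s assume s: "(Some (\<lambda>_. 0, i'), s) \<in> ?k" "s \<noteq> Some (\<lambda>_. 0, i')" "(s, t) \<in> ?k" "s \<noteq> t"
          then obtain g j where g: "s = Some (g, j)" using Some by (cases s) auto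
          have "j = i' \<or> j = i" "g \<in> omega_pow_funs r"
            using s g Some Suc by (auto simp: ord_mult_natLeq_on_iff)
          \<comment> \<open>In copy \<open>i\<close> only the first element is at most
            \<open>t\<close>, and that is \<open>t\<close> itself.\<close>
          moreover have "j \<noteq> i"
            using s(3,4) g Some zero by (auto simp: ord_mult_natLeq_on_iff dest: omega_pow_le_zero)
          ultimately show "cb_rank r s \<in> underS (ord_succ r) (cb_rank r t)"
            using s g Some zero lt_top[of g j] by auto
        qed
      qed
    next
      case False
      define a where "a = min_support r f"
      obtain b where "f b \<noteq> 0" using False by auto
      then have a: "f a \<noteq> 0" "\<And>b. f b \<noteq> 0 \<Longrightarrow> (a, b) \<in> r"
        unfolding a_def using min_support[OF r f(1)] by blast+
      define f' where "f' = f(a := f a - 1)"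
      have f': "f' \<in> omega_pow_funs r"
      proof -
        have "{b. f' b \<noteq> 0} \<subseteq> {b. f b \<noteq> 0}" by (auto simp: f'_def)
        then show ?thesis using f(1) by (auto simp: omega_pow_funs_def intro: finite_subset)
      qed
      have "(f', f) \<in> omega_pow r" "f' \<noteq> f"
        using f f' a(1) by (auto simp: omega_pow_def f'_def aboveS_def fun_eq_iff intro!: exI[of _ a])
      then have u: "Some (f', i) \<in> underS ?k t"
        using Some f f' by (auto simp: underS_def ord_mult_natLeq_on_iff)
      show ?thesis
      proof (rule below[OF u])
        fix s assume s: "(Some (f', i), s) \<in> ?k" "s \<noteq> Some (f', i)" "(s, t) \<in> ?k" "s \<noteq> t"
        then obtain g j where g: "s = Some (g, j)" using Some by (cases s) auto
        have "j = i" "(f', g) \<in> omega_pow r" "(g, f) \<in> omega_pow r"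
          using s g Some by (auto simp: ord_mult_natLeq_on_iff)
        then have "g \<noteq> (\<lambda>_. 0)" "min_support r g \<in> underS r a"
          using min_support_less[OF r f(1) a, of g] s g Some unfolding f'_def by auto
        then show "cb_rank r s \<in> underS (ord_succ r) (cb_rank r t)"
          using g Some False by (auto simp: underS_def a_def)
      qed
    qed
  qed
qed

text \<open>The point 0 is left out although \<open>cb_rank\<close> gives it the top rank, since
  nothing accumulates at it. At the top rank one point, the end of the interval, is enough, because
  only points of smaller rank have to accumulate.\<close>

definition cb_points :: "'a rel \<Rightarrow> nat \<Rightarrow> 'a option \<Rightarrow> (('a \<Rightarrow> nat) \<times> nat) option set" where
  "cb_points r n \<eta> = (case \<eta> of None \<Rightarrow> {None}
    | Some a \<Rightarrow> {Some (f, i) |f i. f \<in> omega_pow_funs r \<and> i < n \<and> f a \<noteq> 0 \<and>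
        (\<forall>b. f b \<noteq> 0 \<longrightarrow> (a, b) \<in> r)})"

text \<open>A neighbourhood of \<open>p\<close> contains an interval \<open>(u, p]\<close>. Adding
  positive multiples of \<open>\<omega>\<^sup>b\<close> to \<open>u\<close>, where \<open>b\<close>
  is the exponent in \<open>\<eta>'\<close>, stays below \<open>p\<close> because \<open>b\<close>
  is smaller than the rank of \<open>p\<close>, and gives infinitely many points with least exponent
  \<open>b\<close>.\<close>

lemma cb_points_accumulate:
  assumes r: "Well_order r" and n: "n \<ge> 1" and p: "p \<in> cb_points r n \<eta>"
    and U: "openin (ord_topology (ord_succ (ord_mult (omega_pow r) (natLeq_on n)))) U" "p \<in> U"
    and \<eta>': "\<eta>' \<in> underS (ord_succ r) \<eta>"
  shows "infinite (U \<inter> cb_points r n \<eta>')"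
proof -
  interpret r: wo_rel r by (simp add: wo_rel_def r)
  let ?m = "ord_mult (omega_pow r) (natLeq_on n)"
  let ?k = "ord_succ ?m"
  have W: "Well_order ?k"
    by (intro Well_order_ord_succ Well_order_ord_mult Well_order_omega_pow r natLeq_on_Well_order)
  \<comment> \<open>\<open>p\<close> is not the least point, so also a neighbourhood containing all
    of \<open>under ?k p\<close> contains an interval \<open>(u, p]\<close>, with \<open>u\<close>
    the point 0.\<close>
  have zp: "Some (\<lambda>_. 0, 0) \<in> underS ?k p"
  proof (cases \<eta>)
    case None
    then show ?thesis using p n
      by (auto simp: cb_points_def underS_def Field_omega_pow_mult[OF r] zero_in_omega_pow_funs)
  next
    case (Some a)
    then obtain f i where f: "p = Some (f, i)" "f \<in> omega_pow_funs r" "i < n" "f a \<noteq> 0"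
      using p by (auto simp: cb_points_def)
    have wo: "wo_rel (omega_pow r)" by (simp add: wo_rel_def Well_order_omega_pow r)
    have "f \<noteq> (\<lambda>_. 0)" using f(4) by auto
    then have "(f, \<lambda>_. 0) \<notin> omega_pow r" using omega_pow_le_zero by blast
    then have "(\<lambda>_. 0, f) \<in> omega_pow r"
      using wo_rel.TOTALS[OF wo] f(2) zero_in_omega_pow_funs unfolding Field_omega_pow by metis
    then show ?thesis using f \<open>f \<noteq> (\<lambda>_. 0)\<close>
      by (auto simp: underS_def ord_mult_natLeq_on_iff zero_in_omega_pow_funs)
  qed
  have "\<exists>u \<in> underS ?k p. aboveS ?k u \<inter> under ?k p \<subseteq> U"
    using openin_ord_topology_left[OF W U] zp by blast
  then obtain u where u: "u \<in> underS ?k p" "aboveS ?k u \<inter> under ?k p \<subseteq> U" by blast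
  have inU: "x \<in> U" if "(u, x) \<in> ?k" "x \<noteq> u" "(x, p) \<in> ?k" for x
    using u(2) that unfolding aboveS_def under_def by blast
  have "u \<noteq> None" using u(1) by (cases p; cases u) (auto simp: underS_def)
  then obtain g j where gj: "u = Some (g, j)" by auto
  have "u \<in> Field ?k" using u(1) by (auto simp: underS_def intro: FieldI1)
  then have g: "g \<in> omega_pow_funs r" "j < n"
    by (auto simp: gj Field_ord_succ Field_omega_pow_mult[OF r])
  obtain b where b: "\<eta>' = Some b" "b \<in> Field r"
  proof (cases \<eta>')
    case None
    then show ?thesis using \<eta>' by (cases \<eta>) (auto simp: underS_def)
  next
    case (Some b)
    then show ?thesis using \<eta>' that by (cases \<eta>) (auto simp: underS_def intro: FieldI1)
  qed
  \<comment> \<open>As an ordinal, \<open>q k\<close> is \<open>g + \<omega>\<^sup>b \<cdot> (k + 1)\<close>, where the terms of \<open>g\<close> below \<open>\<omega>\<^sup>b\<close> are absorbed.\<close>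
  define q where "q k = (\<lambda>c. if c \<in> aboveS r b then g c else if c = b then Suc (g b + k) else 0)" for k
  have q: "q k \<in> omega_pow_funs r" for k
  proof -
    have "{c. q k c \<noteq> 0} \<subseteq> insert b {c. g c \<noteq> 0}" by (auto simp: q_def)
    moreover have "finite (insert b {c. g c \<noteq> 0})" "insert b {c. g c \<noteq> 0} \<subseteq> Field r"
      using g(1) b(2) by (auto simp: omega_pow_funs_def)
    ultimately show ?thesis unfolding omega_pow_funs_def by (auto dest: finite_subset)
  qed
  have bb: "b \<notin> aboveS r b" by (simp add: aboveS_def)
  have gq: "(g, q k) \<in> omega_pow r" "g \<noteq> q k" for k
  proof -
    have "g b < q k b" "\<forall>c \<in> aboveS r b. g c = q k c" using bb by (auto simp: q_def)
    then show "(g, q k) \<in> omega_pow r" "g \<noteq> q k"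
      using g q by (auto simp: omega_pow_def)
  qed
  have "(Some (q k, j), p) \<in> ?k" for k
  proof (cases \<eta>)
    case None
    then show ?thesis using p q g by (auto simp: cb_points_def Field_omega_pow_mult[OF r])
  next
    case (Some a)
    then obtain f i where f: "p = Some (f, i)" "f \<in> omega_pow_funs r" "i < n"
      "\<And>c. f c \<noteq> 0 \<Longrightarrow> (a, c) \<in> r" using p by (auto simp: cb_points_def)
    have ab: "a \<in> aboveS r b" using \<eta>' b Some by (auto simp: underS_def aboveS_def)
    have "j < i \<or> j = i \<and> (g, f) \<in> omega_pow r \<and> g \<noteq> f"
      using u(1) f gj by (auto simp: underS_def ord_mult_natLeq_on_iff)
    then show ?thesis
    proof (elim disjE conjE)
      assume "j < i"
      then show ?thesis using f q g by (simp add: ord_mult_natLeq_on_iff)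
    next
      \<comment> \<open>The comparison of \<open>g\<close> with \<open>f\<close> is decided at a
        place \<open>c\<close> with \<open>f c \<noteq> 0\<close>, hence at or above
        \<open>a\<close> and so above \<open>b\<close>. Changing \<open>g\<close> only at
        \<open>b\<close> and below does not affect it.\<close>
      assume "j = i" "(g, f) \<in> omega_pow r" "g \<noteq> f"
      then obtain c where c: "g c < f c" "\<forall>d \<in> aboveS r c. g d = f d" by (auto simp: omega_pow_def)
      then have "(a, c) \<in> r" using f(4) by simp
      then have cb: "c \<in> aboveS r b" and "aboveS r c \<subseteq> aboveS r b"
        using ab r.TRANS r.ANTISYM by (auto simp: aboveS_def dest: transD antisymD)
      then have "q k c < f c" "\<forall>d \<in> aboveS r c. q k d = f d"
        using c by (auto simp: q_def)
      then have "(q k, f) \<in> omega_pow r" using q f by (auto simp: omega_pow_def)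
      then show ?thesis using \<open>j = i\<close> f q by (simp add: ord_mult_natLeq_on_iff)
    qed
  qed
  moreover have "(u, Some (q k, j)) \<in> ?k" "Some (q k, j) \<noteq> u" for k
    using gq gq(2)[symmetric] g q by (auto simp: gj ord_mult_natLeq_on_iff)
  ultimately have "Some (q k, j) \<in> U" for k
    using inU by blast
  moreover have "Some (q k, j) \<in> cb_points r n \<eta>'" for k
    using q g b bb r.REFL
    by (auto simp: cb_points_def q_def aboveS_def refl_on_def split: if_splits)
  ultimately have "range (\<lambda>k. Some (q k, j)) \<subseteq> U \<inter> cb_points r n \<eta>'" by blast
  moreover have "inj (\<lambda>k. Some (q k, j))"
  proof (rule injI)
    fix k l assume "Some (q k, j) = Some (q l, j)"
    then have "q k b = q l b" by simp
    then show "k = l" using bb by (simp add: q_def)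
  qed
  ultimately show ?thesis using range_inj_infinite infinite_super by blast
qed

section \<open>Coarse maps between the spaces over two different ordinals\<close>

text \<open>Identify \<open>\<gamma>\<close> with the segment of \<open>\<alpha>\<close> below some
  \<open>a0\<close>. All ranks on the target interval then lie strictly below the top rank
  \<open>None\<close> of \<open>ord_succ \<alpha>\<close>, which the end point of the source
  interval has. A ratio \<open>c / a\<close> below 2 would transfer that rank.\<close>

lemma no_coarse_map:
  fixes \<gamma> :: "'a rel" and \<alpha> :: "'b rel"
  assumes less: "\<gamma> <o \<alpha>" and n: "n \<ge> 1" "m \<ge> 1"
  defines "X \<equiv> C_interval (ord_mult (omega_pow \<alpha>) (natLeq_on m))"
    and "Y \<equiv> C_interval (ord_mult (omega_pow \<gamma>) (natLeq_on n))"
  assumes h: "h \<in> mspace X \<rightarrow> mspace Y"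
    and lower: "\<And>x y. x \<in> mspace X \<Longrightarrow> y \<in> mspace X \<Longrightarrow> a * mdist X x y - b \<le> mdist Y (h x) (h y)"
    and upper: "\<And>x y. x \<in> mspace X \<Longrightarrow> y \<in> mspace X \<Longrightarrow> mdist Y (h x) (h y) \<le> c * mdist X x y + b"
    and pos: "0 < a" "0 < c" "0 \<le> b"
  shows "2 * a \<le> c"
proof (rule ccontr)
  assume "\<not> 2 * a \<le> c"
  then have c: "c < 2 * a" by simp
  have W: "Well_order \<gamma>" "Well_order \<alpha>" using less by (auto simp: ordLess_def)
  obtain a0 where a0: "a0 \<in> Field \<alpha>" "\<gamma> =o Restr \<alpha> (underS \<alpha> a0)"
    using less ordLess_iff_ordIso_Restr[OF W(2,1)] by blast
  then obtain e where e: "iso \<gamma> (Restr \<alpha> (underS \<alpha> a0)) e" by (auto simp: ordIso_def)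
  have e_mono: "(e x, e y) \<in> \<alpha>" if "(x, y) \<in> \<gamma>" for x y
    using iso_forward[OF that e] by blast
  have e_under: "e x \<in> underS \<alpha> a0" if "x \<in> Field \<gamma>" for x
  proof -
    have "(x, x) \<in> \<gamma>"
      using that wo_rel.REFL[of \<gamma>] W(1) by (auto simp: wo_rel_def refl_on_def)
    from iso_forward[OF this e] show ?thesis by blast
  qed
  have e_inj: "inj_on e (Field \<gamma>)" using e by (auto simp: iso_iff2 bij_betw_def)
  \<comment> \<open>The top rank over \<open>\<gamma>\<close> goes to \<open>a0\<close>, just above
    the image of \<open>e\<close>, and so stays below the top rank over
    \<open>\<alpha>\<close>.\<close>
  define e' where "e' \<eta> = Some (case \<eta> of None \<Rightarrow> a0 | Some x \<Rightarrow> e x)" for \<eta>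
  have e'_mono: "e' \<eta> \<in> underS (ord_succ \<alpha>) (e' \<theta>)" if "\<eta> \<in> underS (ord_succ \<gamma>) \<theta>" for \<eta> \<theta>
  proof (cases \<eta>)
    case None
    then show ?thesis using that by (cases \<theta>) (auto simp: underS_def)
  next
    case (Some x)
    show ?thesis
    proof (cases \<theta>)
      case None
      then show ?thesis using that Some e_under by (auto simp: underS_def e'_def)
    next
      case (Some y)
      then show ?thesis using that \<open>\<eta> = Some x\<close> e_mono e_inj
        by (auto simp: underS_def e'_def dest: inj_onD intro: FieldI1 FieldI2)
    qed
  qed
  define \<rho> where "\<rho> t = e' (cb_rank \<gamma> t)" for t
  let ?K = "ord_mult (omega_pow \<gamma>) (natLeq_on n)" and ?L = "ord_mult (omega_pow \<alpha>) (natLeq_on m)"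
  have \<rho>: "\<rho> t \<in> Some ` Field \<alpha>" if "t \<in> Field (ord_succ ?K)" for t
  proof (cases "cb_rank \<gamma> t")
    case None
    then show ?thesis using a0 by (simp add: \<rho>_def e'_def)
  next
    case (Some x)
    then obtain f i where f: "t = Some (f, i)" "f \<noteq> (\<lambda>_. 0)" "x = min_support \<gamma> f"
      by (cases "(\<gamma>, t)" rule: cb_rank.cases) (auto split: if_splits)
    then have "f \<in> omega_pow_funs \<gamma>"
      using that by (auto simp: Field_ord_succ Field_omega_pow_mult[OF W(1)])
    moreover obtain b where "f b \<noteq> 0" using f(2) by auto
    ultimately have "x \<in> Field \<gamma>" using min_support(2)[OF W(1)] f(3) by (auto intro: FieldI1)
    then show ?thesis using e_under Some
      by (auto simp: \<rho>_def e'_def underS_def intro: FieldI1)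
  qed
  have "\<exists>t \<in> Field (ord_succ ?K). (None, \<rho> t) \<in> ord_succ \<alpha>"
  proof (rule coarse_rank_transfer[where \<beta> = ?L and h = h and a = a and b = b and c = c
        and P = "cb_points \<alpha> m" and p = None])
    show "Well_order ?L" "Well_order ?K"
      by (intro Well_order_ord_mult Well_order_omega_pow natLeq_on_Well_order W)+
    show "Well_order (ord_succ \<alpha>)" using W(2) by (rule Well_order_ord_succ)
    show "\<rho> t \<in> Field (ord_succ \<alpha>)" if "t \<in> Field (ord_succ ?K)" for t
      using \<rho>[OF that] by (auto simp: Field_ord_succ)
    show "\<exists>V. openin (ord_topology (ord_succ ?K)) V \<and> t \<in> V \<and>
        (\<forall>s \<in> V - {t}. \<rho> s \<in> underS (ord_succ \<alpha>) (\<rho> t))" if "t \<in> Field (ord_succ ?K)" for t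
      using cb_rank_isolated[OF W(1) n(1) that] e'_mono unfolding \<rho>_def by blast
    show "infinite (U \<inter> cb_points \<alpha> m \<eta>')"
      if "p \<in> cb_points \<alpha> m \<eta>" "openin (ord_topology (ord_succ ?L)) U" "p \<in> U"
        "\<eta>' \<in> underS (ord_succ \<alpha>) \<eta>" for \<eta> p U \<eta>'
      using cb_points_accumulate[OF W(2) n(2) that] .
    show "None \<in> cb_points \<alpha> m None" by (simp add: cb_points_def)
    show "None \<in> Field (ord_succ \<alpha>)" "None \<in> Field (ord_succ ?L)" by (simp_all add: Field_ord_succ)
  qed (use h lower upper pos c in \<open>simp_all add: X_def Y_def\<close>)
  then obtain t where "t \<in> Field (ord_succ ?K)" "(None, \<rho> t) \<in> ord_succ \<alpha>" by blast
  with \<rho>[of t] show False by auto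
qed

section \<open>Nets\<close>

text \<open>Each point moves by at most the covering radius of the net, so by the triangle
  inequality a distance changes by at most twice that radius.\<close>

lemma net_retraction:
  assumes "is_net X N"
  obtains \<pi> b where "b \<ge> 0" "\<pi> \<in> mspace X \<rightarrow> N"
    "\<forall>x \<in> mspace X. \<forall>y \<in> mspace X. \<bar>mdist X (\<pi> x) (\<pi> y) - mdist X x y\<bar> \<le> b"
proof -
  obtain b where N: "N \<subseteq> mspace X" "b > 0" "\<forall>x \<in> mspace X. \<exists>y \<in> N. mdist X x y \<le> b"
    using assms by (auto simp: is_net_def)
  from N(3) obtain \<pi> where \<pi>: "\<And>x. x \<in> mspace X \<Longrightarrow> \<pi> x \<in> N \<and> mdist X x (\<pi> x) \<le> b"
    by metis
  have "\<bar>mdist X (\<pi> x) (\<pi> y) - mdist X x y\<bar> \<le> 2 * b" if x: "x \<in> mspace X" and y: "y \<in> mspace X" for x y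
  proof -
    have \<pi>x: "\<pi> x \<in> mspace X" and \<pi>y: "\<pi> y \<in> mspace X" using \<pi> N(1) x y by blast+
    have "mdist X x y \<le> mdist X x (\<pi> x) + mdist X (\<pi> x) y"
      "mdist X (\<pi> x) y \<le> mdist X (\<pi> x) (\<pi> y) + mdist X (\<pi> y) y"
      "mdist X (\<pi> x) (\<pi> y) \<le> mdist X (\<pi> x) x + mdist X x (\<pi> y)"
      "mdist X x (\<pi> y) \<le> mdist X x y + mdist X y (\<pi> y)"
      using x y \<pi>x \<pi>y by (auto intro: mdist_triangle)
    then show ?thesis
      using \<pi>[OF x] \<pi>[OF y] by (simp add: mdist_commute abs_le_iff)
  qed
  then show thesis using \<pi> N(2) by (intro that[of "2 * b" \<pi>]) auto
qed

text \<open>Precomposing \<open>f\<close> with the map into the net keeps both multiplicative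
  constants. The additive errors are \<open>C\<^sub>1 * b\<close> and \<open>C\<^sub>2 * b\<close>,
  and their sum serves for both bounds.\<close>

lemma coarse_map_of_net_map:
  assumes "is_net X N" and f: "f \<in> N \<rightarrow> mspace Y"
    and C: "0 < C\<^sub>1" "0 < C\<^sub>2" "\<forall>x \<in> N. \<forall>y \<in> N.
      C\<^sub>1 * mdist X x y \<le> mdist Y (f x) (f y) \<and> mdist Y (f x) (f y) \<le> C\<^sub>2 * mdist X x y"
  obtains h b where "h \<in> mspace X \<rightarrow> mspace Y" "b \<ge> 0"
    "\<forall>x \<in> mspace X. \<forall>y \<in> mspace X. C\<^sub>1 * mdist X x y - b \<le> mdist Y (h x) (h y)"
    "\<forall>x \<in> mspace X. \<forall>y \<in> mspace X. mdist Y (h x) (h y) \<le> C\<^sub>2 * mdist X x y + b"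
proof -
  obtain \<pi> b where \<pi>: "b \<ge> 0" "\<pi> \<in> mspace X \<rightarrow> N"
    "\<forall>x \<in> mspace X. \<forall>y \<in> mspace X. \<bar>mdist X (\<pi> x) (\<pi> y) - mdist X x y\<bar> \<le> b"
    by (rule net_retraction[OF assms(1)]) (rule that)
  have *: "C\<^sub>1 * (mdist X x y - b) \<le> mdist Y (f (\<pi> x)) (f (\<pi> y)) \<and>
      mdist Y (f (\<pi> x)) (f (\<pi> y)) \<le> C\<^sub>2 * (mdist X x y + b)"
    if "x \<in> mspace X" "y \<in> mspace X" for x y
  proof -
    have "C\<^sub>1 * (mdist X x y - b) \<le> C\<^sub>1 * mdist X (\<pi> x) (\<pi> y)"
      "C\<^sub>2 * mdist X (\<pi> x) (\<pi> y) \<le> C\<^sub>2 * (mdist X x y + b)"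
      using \<pi>(3)[rule_format, OF that] C(1,2) by (intro mult_left_mono; linarith)+
    moreover have "\<pi> x \<in> N" "\<pi> y \<in> N" using \<pi>(2) that by auto
    ultimately show ?thesis using C(3)[rule_format, of "\<pi> x" "\<pi> y"] by linarith
  qed
  show thesis
  proof (rule that[of "f \<circ> \<pi>" "(C\<^sub>1 + C\<^sub>2) * b"])
    show "f \<circ> \<pi> \<in> mspace X \<rightarrow> mspace Y" using f \<pi>(2) by auto
    show "0 \<le> (C\<^sub>1 + C\<^sub>2) * b" using C \<pi>(1) by simp
    have "0 \<le> C\<^sub>1 * b" "0 \<le> C\<^sub>2 * b" using C \<pi>(1) by simp_all
    then have "C\<^sub>1 * mdist X x y - (C\<^sub>1 + C\<^sub>2) * b \<le> mdist Y (f (\<pi> x)) (f (\<pi> y)) \<and>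
        mdist Y (f (\<pi> x)) (f (\<pi> y)) \<le> C\<^sub>2 * mdist X x y + (C\<^sub>1 + C\<^sub>2) * b"
      if "x \<in> mspace X" "y \<in> mspace X" for x y
      using *[OF that] by (simp add: algebra_simps)
    then show "\<forall>x \<in> mspace X. \<forall>y \<in> mspace X.
        C\<^sub>1 * mdist X x y - (C\<^sub>1 + C\<^sub>2) * b \<le> mdist Y ((f \<circ> \<pi>) x) ((f \<circ> \<pi>) y)"
      "\<forall>x \<in> mspace X. \<forall>y \<in> mspace X.
        mdist Y ((f \<circ> \<pi>) x) ((f \<circ> \<pi>) y) \<le> C\<^sub>2 * mdist X x y + (C\<^sub>1 + C\<^sub>2) * b"
      by simp_all
  qed
qed

section \<open>From net homeomorphisms to the lower bound for the distortion\<close>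

theorem corollary14:
  fixes \<gamma> :: "'a rel" and \<alpha> :: "'b rel" and n m :: nat
  assumes "\<gamma> <o omega_1" and "\<alpha> <o omega_1"
    and "\<not> \<gamma> =o \<alpha>"
    and "n \<ge> 1" and "m \<ge> 1"
  shows "net_distance (C_interval (ord_mult (omega_pow \<gamma>) (natLeq_on n)))
                      (C_interval (ord_mult (omega_pow \<alpha>) (natLeq_on m))) \<ge> 2"
proof -
  define X where "X = C_interval (ord_mult (omega_pow \<gamma>) (natLeq_on n))"
  define Y where "Y = C_interval (ord_mult (omega_pow \<alpha>) (natLeq_on m))"
  have W: "Well_order \<gamma>" "Well_order \<alpha>"
    using assms(1,2) by (auto simp: ordLess_def)
  have "2 \<le> C\<^sub>2 / C\<^sub>1"
    if N: "is_net X N" "is_net Y M"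
      and f: "lipschitz_homeomorphism (submetric X N) (submetric Y M) f"
      and C: "(C\<^sub>1, C\<^sub>2) \<in> bilipschitz_constants (submetric X N) (submetric Y M) f"
    for N M f C\<^sub>1 C\<^sub>2
  proof -
    have sub: "N \<subseteq> mspace X" "M \<subseteq> mspace Y" using N by (auto simp: is_net_def)
    then have fN: "f ` N = M"
      using f by (simp add: lipschitz_homeomorphism_def inf_absorb1)
    have pos: "0 < C\<^sub>1" "0 < C\<^sub>2" and bil: "\<forall>x \<in> N. \<forall>y \<in> N.
        C\<^sub>1 * mdist X x y \<le> mdist Y (f x) (f y) \<and> mdist Y (f x) (f y) \<le> C\<^sub>2 * mdist X x y"
      using C sub by (auto simp: bilipschitz_constants_def)
    \<comment> \<open>\<open>no_coarse_map\<close> concerns maps out of the space over the larger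
      ordinal, so \<open>f\<close> serves one case and its inverse the other.\<close>
    have "\<gamma> <o \<alpha> \<or> \<alpha> <o \<gamma>"
      using assms(3) W not_ordLess_iff_ordLeq ordLeq_iff_ordLess_or_ordIso by blast
    then show ?thesis
    proof
      assume less: "\<alpha> <o \<gamma>"
      have "f \<in> N \<rightarrow> mspace Y" using fN sub by auto
      from coarse_map_of_net_map[OF N(1) this pos bil] obtain h b where
        "h \<in> mspace X \<rightarrow> mspace Y" "b \<ge> 0"
        "\<forall>x \<in> mspace X. \<forall>y \<in> mspace X. C\<^sub>1 * mdist X x y - b \<le> mdist Y (h x) (h y)"
        "\<forall>x \<in> mspace X. \<forall>y \<in> mspace X. mdist Y (h x) (h y) \<le> C\<^sub>2 * mdist X x y + b"
        by metis
      then have "2 * C\<^sub>1 \<le> C\<^sub>2"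
        using pos unfolding X_def Y_def by (intro no_coarse_map[OF less assms(5,4)]) blast+
      then show ?thesis using pos by (simp add: le_divide_eq)
    next
      assume less: "\<gamma> <o \<alpha>"
      \<comment> \<open>The inverse has the constants \<open>1 / C\<^sub>2\<close> and
        \<open>1 / C\<^sub>1\<close>, whose ratio is again
        \<open>C\<^sub>2 / C\<^sub>1\<close>.\<close>
      define g where "g = inv_into N f"
      have g: "g y \<in> N" "f (g y) = y" if "y \<in> M" for y
        using that fN by (auto simp: g_def inv_into_into f_inv_into_f)
      have gb: "\<forall>x \<in> M. \<forall>y \<in> M. 1 / C\<^sub>2 * mdist Y x y \<le> mdist X (g x) (g y) \<and>
          mdist X (g x) (g y) \<le> 1 / C\<^sub>1 * mdist Y x y"
      proof (intro ballI)
        fix x y assume xy: "x \<in> M" "y \<in> M"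
        from bil[rule_format, OF g(1)[OF xy(1)] g(1)[OF xy(2)]]
        show "1 / C\<^sub>2 * mdist Y x y \<le> mdist X (g x) (g y) \<and>
            mdist X (g x) (g y) \<le> 1 / C\<^sub>1 * mdist Y x y"
          using g(2) xy pos by (simp add: field_simps)
      qed
      have gM: "g \<in> M \<rightarrow> mspace X" "0 < 1 / C\<^sub>2" "0 < 1 / C\<^sub>1" using g sub pos by auto
      obtain h b where
        "h \<in> mspace Y \<rightarrow> mspace X" "b \<ge> 0"
        "\<forall>x \<in> mspace Y. \<forall>y \<in> mspace Y. 1 / C\<^sub>2 * mdist Y x y - b \<le> mdist X (h x) (h y)"
        "\<forall>x \<in> mspace Y. \<forall>y \<in> mspace Y. mdist X (h x) (h y) \<le> 1 / C\<^sub>1 * mdist Y x y + b"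
        by (rule coarse_map_of_net_map[OF N(2) gM gb]) (rule that)
      then have "2 * (1 / C\<^sub>2) \<le> 1 / C\<^sub>1"
        using gM(2,3) unfolding X_def Y_def
        by (intro no_coarse_map[OF less assms(4,5)]) blast+
      then show ?thesis using pos by (simp add: field_simps)
    qed
  qed
  then have "2 \<le> distortion (submetric X N) (submetric Y M) f"
    if "is_net X N" "is_net Y M" "lipschitz_homeomorphism (submetric X N) (submetric Y M) f" for N M f
    using that unfolding distortion_def by (intro INF_greatest) (auto simp: numeral_eq_ereal)
  then show ?thesis
    unfolding net_distance_def X_def[symmetric] Y_def[symmetric] by (intro Inf_greatest) blast
qed

end
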